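(* Let $(L,L')$ be a cross on the germ of smooth complex surface $(S,o)$ and let $C$ be a reduced curve singularity on $(S,o)$ not containing the branch $L$. Then the Newton polygon $\mathcal N_{L,L'}(C)$ of $C$ with respect to the cross $(L,L')$ is equal to the Minkowski sum $$\mathcal N_{L,L'}(C)=\sum_l \mathbf i_L(C_l)\; \mathcal E\bigl(\mathbf e_L(C_l\wedge_L L')\bigr),$$ where $C_l$ runs through the branches of $C$, and $\mathcal E(a)$ denotes the elementary Newton polygon $\left\{\frac{a}{\overline{\ 1\ }}\right\}$.
   Context: $(S,o)$ has completed local ring $\hat{\mathcal O}_{S,o}\simeq\mathbb C[[x,y]]$. A curve singularity is a formal germ of effective divisor defined by a nonzero non-unit $f\in\hat{\mathcal O}_{S,o}$; it is a branch if $f$ is irreducible. A cross is an ordered pair $(L,L')$ of transversal smooth branches; coordinates $(x,y)$ define it if $L=Z(x)$, $L'=Z(y)$. **Newton polygons.** If $(x,y)$ defines the cross and $f\in\mathbb C[[x,y]]$ defines $C$, then $\mathcal N_{L,L'}(C)=\mathcal N(f)$ is the convex hull of $\mathrm{Supp}(f)+\mathbb R_+^2$ in $\mathbb R^2$, where $\mathrm{Supp}(f)\subset\mathbb N^2$ is the set of exponents of the monomials of $f$ with nonzero coefficient (it depends only on $L,L',C$). The definition is extended to series with rational exponents. The elementary polygon $\mathcal E(a)$ (denoted in the paper by a fraction-like symbol with $a$ above and $1$ below) is $\mathcal N(x^a+y)$ for $a\in\mathbb Q_+^*$ and $\mathcal N(y)$ for $a=\infty$. For $d\in\mathbb N^*$,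 $d\,\mathcal E(a)$ is the Minkowski sum of $d$ copies of $\mathcal E(a)$. **Eggers-Wall tree.** Let $L=Z(x)$. A reduced curve $D$ not containing $L$ has a finite set $\mathcal Z_x(D)$ of Newton-Puiseux roots $\eta(x)\in\bigcup_n\mathbb C[[x^{1/n}]]$, with defining function a unit times $\prod_{\eta\in\mathcal Z_x(D)}(y-\eta(x))$. For distinct branches $A,B\ne L$, $k_x(A,B)=\max\{\nu_x(\xi-\xi'):\xi\in\mathcal Z_x(A),\xi'\in\mathcal Z_x(B)\}$; the characteristic exponents of $A$ are the numbers $\nu_x(\xi-\xi')$, $\xi\ne\xi'$ in $\mathcal Z_x(A)$. For a branch $A\neq L$, $\Theta_L(A)$ is a segment with a homeomorphism $\mathbf e_L:\Theta_L(A)\to[0,\infty]$ (exponent), $\mathbf e_L^{-1}(0)$ being labeled $L$ and $\mathbf e_L^{-1}(\infty)$ labeled $A$; the index $\mathbf i_L(P)\in\mathbb N^*$ is the lowest common multiple of the denominators of the characteristic exponents of $A$ which are $<\mathbf e_L(P)$. For a reduced curve $D$, $\Theta_L(D)$ is obtained by gluing the segments of its branches, identifying for $l\ne m$ the points of $\Theta_L(D_l),\Theta_L(D_m)$ of equal exponent $\le k_x(D_l,D_m)$; $\mathbf e_L,\mathbf i_L$ glue to functions on $\Theta_L(D)$. It is rooted at $L$, which defines a partial order $\preceq_L$; $A\wedge_LB$ is the infimum of the points labeled $A$ and $B$. Here everything is considered in $\Theta_L(C+L')$ (or of its reduction), and $\mathbf i_L(C_l)$ is the index of the leaf labeled $C_l$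 (equal to the intersection number $L\cdot C_l$). If $C_l=L'$ then $\mathbf e_L(C_l\wedge_LL')=\infty$. *)

theory Defs
  imports "HOL-Analysis.Analysis" "HOL-Computational_Algebra.Computational_Algebra"
begin

section \<open>Coordinates, curves and crosses\<close>

text \<open>
  The ring C[[x, y]] is rendered as C[[x]][[y]]: the outer variable is y, the inner one is x, so
  \<^term>\<open>fps_nth (fps_nth F j) i\<close> is the coefficient of the monomial with exponent (i, j).
\<close>

type_synonym series2 = "complex fps fps"

definition coord_x :: series2 where "coord_x = fps_const fps_X"
definition coord_y :: series2 where "coord_y = fps_X"

text \<open>
  A germ of smooth surface is given by its completed local ring \<open>'r\<close>. A system of local
  coordinates is an isomorphism of \<open>'r\<close> with C[[x, y]]; the coordinates themselves are the
  preimages of x and y, and the complex structure of \<open>'r\<close> is transported along the isomorphism.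
\<close>

definition local_coordinates :: "('r::comm_ring_1 \<Rightarrow> series2) \<Rightarrow> bool" where
  "local_coordinates \<phi> \<longleftrightarrow> bij \<phi> \<and> \<phi> 1 = 1 \<and>
     (\<forall>a b. \<phi> (a + b) = \<phi> a + \<phi> b) \<and> (\<forall>a b. \<phi> (a * b) = \<phi> a * \<phi> b)"

text \<open>
  An effective divisor is represented by the principal ideal of its defining functions; hence
  inclusion of divisors is reverse inclusion of ideals.
\<close>

definition Zdiv :: "'r::comm_ring_1 \<Rightarrow> 'r set" where
  "Zdiv f = {g. f dvd g}"

definition curve_singularity :: "'r::comm_ring_1 set \<Rightarrow> bool" where
  "curve_singularity C \<longleftrightarrow> (\<exists>f. f \<noteq> 0 \<and> \<not> f dvd 1 \<and> C = Zdiv f)"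

definition branch :: "'r::comm_ring_1 set \<Rightarrow> bool" where
  "branch A \<longleftrightarrow> (\<exists>f. irreducible f \<and> A = Zdiv f)"

definition branches :: "'r::comm_ring_1 set \<Rightarrow> 'r set set" where
  "branches C = {A. branch A \<and> C \<subseteq> A}"

definition reduced_curve :: "'r::comm_ring_1 set \<Rightarrow> bool" where
  "reduced_curve C \<longleftrightarrow> (\<exists>f. squarefree f \<and> C = Zdiv f)"

text \<open>The sum of the divisors of f and g is the divisor of f g.\<close>

definition curve_sum :: "'r::comm_ring_1 set \<Rightarrow> 'r set \<Rightarrow> 'r set" where
  "curve_sum C D = {a * b | a b. a \<in> C \<and> b \<in> D}"

text \<open>
  A defining function is unique up to a unit; nothing below depends on the choice.
\<close>

definition defining_fn :: "'r::comm_ring_1 set \<Rightarrow> 'r" where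
  "defining_fn C = (SOME f. C = Zdiv f)"

definition max_ideal :: "'r::comm_ring_1 set" where
  "max_ideal = {a. \<not> a dvd 1}"

definition max_ideal_sq :: "'r::comm_ring_1 set" where
  "max_ideal_sq = {\<Sum>i<n. a i * b i | (n::nat) a b. \<forall>i<n. a i \<in> max_ideal \<and> b i \<in> max_ideal}"

definition smooth_branch :: "'r::comm_ring_1 set \<Rightarrow> bool" where
  "smooth_branch A \<longleftrightarrow> branch A \<and> \<not> A \<subseteq> max_ideal_sq"

text \<open>
  Two smooth branches are transversal if their defining functions have linearly independent
  differentials at the base point, i.e. if they generate the maximal ideal.
\<close>

definition is_cross :: "'r::comm_ring_1 set \<Rightarrow> 'r set \<Rightarrow> bool" where
  "is_cross L L' \<longleftrightarrow> smooth_branch L \<and> smooth_branch L' \<and>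
     {a + b | a b. a \<in> L \<and> b \<in> L'} = max_ideal"

definition defines_cross :: "('r::comm_ring_1 \<Rightarrow> series2) \<Rightarrow> 'r set \<Rightarrow> 'r set \<Rightarrow> bool" where
  "defines_cross \<phi> L L' \<longleftrightarrow> L = Zdiv (inv \<phi> coord_x) \<and> L' = Zdiv (inv \<phi> coord_y)"

section \<open>Newton polygons\<close>

definition newton_hull :: "(real \<times> real) set \<Rightarrow> (real \<times> real) set" where
  "newton_hull S = convex hull {p + q | p q. p \<in> S \<and> 0 \<le> fst q \<and> 0 \<le> snd q}"

definition supp :: "series2 \<Rightarrow> (real \<times> real) set" where
  "supp F = {(real i, real j) | i j. fps_nth (fps_nth F j) i \<noteq> 0}"

definition newton_polygon :: "('r::comm_ring_1 \<Rightarrow> series2) \<Rightarrow> 'r set \<Rightarrow> (real \<times> real) set" where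
  "newton_polygon \<phi> C = newton_hull (supp (\<phi> (defining_fn C)))"

text \<open>
  The supports of y and of \<open>x^a + y\<close> are spelled out, since a need not be an integer.
\<close>

definition elementary_polygon :: "ennreal \<Rightarrow> (real \<times> real) set" where
  "elementary_polygon a =
     (if a = \<infinity> then newton_hull {(0, 1)} else newton_hull {(enn2real a, 0), (0, 1)})"

text \<open>Addition of sets is Minkowski addition (\<^theory>\<open>HOL-Library.Set_Algebras\<close>).\<close>

definition minkowski_multiple :: "nat \<Rightarrow> (real \<times> real) set \<Rightarrow> (real \<times> real) set" where
  "minkowski_multiple d N = (\<Sum>i<d. N)"

section \<open>Newton-Puiseux roots\<close>

text \<open>
  A Puiseux series is represented by its coefficient function; \<^term>\<open>rat\<close> is the type of exponents.
  The following is the series h(x^(1/n)).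
\<close>

definition puiseux :: "nat \<Rightarrow> complex fps \<Rightarrow> rat \<Rightarrow> complex" where
  "puiseux n h q = (if q * of_nat n \<in> \<nat> then fps_nth h (nat \<lfloor>q * of_nat n\<rfloor>) else 0)"

text \<open>
  After the substitution \<open>x = t^n\<close>, the equation F(x, h(x^(1/n))) = 0 becomes
  \<open>F(t^n, h(t)) = 0\<close>, a series which converges in the X-adic topology of the type fps because
  h(0) = 0.
\<close>

definition newton_puiseux_roots :: "series2 \<Rightarrow> (rat \<Rightarrow> complex) set" where
  "newton_puiseux_roots F = {puiseux n h | n h. 0 < n \<and> fps_nth h 0 = 0 \<and>
     (\<lambda>j. fps_compose (fps_nth F j) (fps_X ^ n) * h ^ j) sums 0}"

definition roots_of :: "('r::comm_ring_1 \<Rightarrow> series2) \<Rightarrow> 'r set \<Rightarrow> (rat \<Rightarrow> complex) set" where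
  "roots_of \<phi> A = newton_puiseux_roots (\<phi> (defining_fn A))"

text \<open>The order in x, for nonzero series.\<close>

definition puiseux_order :: "(rat \<Rightarrow> complex) \<Rightarrow> rat" where
  "puiseux_order \<eta> = (LEAST q. \<eta> q \<noteq> 0)"

text \<open>The order of coincidence, meant for distinct branches.\<close>

definition coincidence :: "('r::comm_ring_1 \<Rightarrow> series2) \<Rightarrow> 'r set \<Rightarrow> 'r set \<Rightarrow> rat" where
  "coincidence \<phi> A B =
     Max {puiseux_order (\<xi> - \<xi>') | \<xi> \<xi>'. \<xi> \<in> roots_of \<phi> A \<and> \<xi>' \<in> roots_of \<phi> B}"

definition char_exponents :: "('r::comm_ring_1 \<Rightarrow> series2) \<Rightarrow> 'r set \<Rightarrow> rat set" where
  "char_exponents \<phi> A =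
     {puiseux_order (\<xi> - \<xi>') | \<xi> \<xi>'. \<xi> \<in> roots_of \<phi> A \<and> \<xi>' \<in> roots_of \<phi> A \<and> \<xi> \<noteq> \<xi>'}"

section \<open>The Eggers-Wall tree\<close>

text \<open>
  The segment of a branch A consists of the pairs (A, s), where s in [0, \<open>\<infinity>\<close>] is the exponent.
  A point of the tree of a curve D is a class of such pairs under the gluing relation. Only the
  set of branches of D matters, so D and its reduction have the same tree.
\<close>

type_synonym 'r ew_point = "('r set \<times> ennreal) set"

definition ennreal_of_rat :: "rat \<Rightarrow> ennreal" where
  "ennreal_of_rat q = ennreal (real_of_rat q)"

definition ew_gluing ::
  "('r::comm_ring_1 \<Rightarrow> series2) \<Rightarrow> 'r set \<Rightarrow> (('r set \<times> ennreal) \<times> ('r set \<times> ennreal)) set" where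
  "ew_gluing \<phi> D = {((A, s), (B, t)). A \<in> branches D \<and> B \<in> branches D \<and> s = t \<and>
     (A = B \<or> s \<le> ennreal_of_rat (coincidence \<phi> A B))}"

definition ew_tree :: "('r::comm_ring_1 \<Rightarrow> series2) \<Rightarrow> 'r set \<Rightarrow> 'r ew_point set" where
  "ew_tree \<phi> D = (branches D \<times> UNIV) // ew_gluing \<phi> D"

definition ew_leaf :: "('r::comm_ring_1 \<Rightarrow> series2) \<Rightarrow> 'r set \<Rightarrow> 'r set \<Rightarrow> 'r ew_point" where
  "ew_leaf \<phi> D A = ew_gluing \<phi> D `` {(A, \<infinity>)}"

definition ew_exponent :: "'r ew_point \<Rightarrow> ennreal" where
  "ew_exponent P = the_elem (snd ` P)"

definition segment_index :: "('r::comm_ring_1 \<Rightarrow> series2) \<Rightarrow> 'r set \<Rightarrow> ennreal \<Rightarrow> nat" where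
  "segment_index \<phi> A s =
     Lcm {nat (snd (quotient_of q)) | q. q \<in> char_exponents \<phi> A \<and> ennreal_of_rat q < s}"

definition ew_index :: "('r::comm_ring_1 \<Rightarrow> series2) \<Rightarrow> 'r ew_point \<Rightarrow> nat" where
  "ew_index \<phi> P = the_elem ((\<lambda>(A, s). segment_index \<phi> A s) ` P)"

text \<open>P precedes Q if P lies on the path from the root (the point of exponent 0) to Q.\<close>

definition ew_le :: "'r ew_point \<Rightarrow> 'r ew_point \<Rightarrow> bool" where
  "ew_le P Q \<longleftrightarrow> (\<exists>A s t. (A, s) \<in> P \<and> (A, t) \<in> Q \<and> s \<le> t)"

definition ew_meet ::
  "('r::comm_ring_1 \<Rightarrow> series2) \<Rightarrow> 'r set \<Rightarrow> 'r set \<Rightarrow> 'r set \<Rightarrow> 'r ew_point" where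
  "ew_meet \<phi> D A B = (THE P. P \<in> ew_tree \<phi> D \<and>
     ew_le P (ew_leaf \<phi> D A) \<and> ew_le P (ew_leaf \<phi> D B) \<and>
     (\<forall>Q\<in>ew_tree \<phi> D. ew_le Q (ew_leaf \<phi> D A) \<and> ew_le Q (ew_leaf \<phi> D B) \<longrightarrow> ew_le Q P))"

end

theory Submission
  imports Defs
begin

text \<open>
  A Newton-Puiseux root \<open>h(x^(1/n))\<close> of a series F, with n minimal, has n distinct conjugates under
  \<open>x^(1/n) \<mapsto> \<omega> x^(1/n)\<close>. The product G of the corresponding factors \<open>y - h(\<omega>^k x^(1/n))\<close> has
  coefficients in C[[x]], and G divides a series exactly when h is a root of that series, so G is prime.
  Hence a squarefree F which is not divisible by x is a unit times a product of distinct such G,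
  one for each branch. All conjugates have the same order \<open>e/n\<close>, which is the exponent at which the
  branch leaves the segment of L'; so the Newton polygon of G is spanned by (e, 0) and (0, n), and n
  is the least common multiple of the denominators of the differences of conjugates, that is, the
  index of the leaf. The Newton polygon of a product is the Minkowski sum of those of the factors,
  because the minimum of a positive weight on the support is additive.
\<close>

text \<open>Puiseux series are bare coefficient functions here, without a product of series. The
  algebra therefore takes place after the substitution x = t^n, where a root becomes an ordinary
  series h in t and F(t^n, h(t)) = 0 says that y - h divides F(t^n, y).

  The order of F(0, y) plays the part of a degree in y. It is finite exactly if x does not divide F,
  it is then positive for a non-unit, and it is additive. Positivity makes Newton-Puiseux applicable
  and so yields a prime factor; additivity makes the splitting off of factors terminate.

  The branch L' has the zero series as its only root. So its coincidence with another branch is the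
  order of any root of that branch, while h = 0 stands for L' itself, with exponent infinity. Orders
  are compared through a predicate that covers the zero series as well.

  For the Minkowski sum, separating a point from a polygon gives weights that are only nonnegative,
  whereas leading exponents are formed for positive ones; a small perturbation bridges the
  gap.\<close>

unbundle no vec_syntax
unbundle fps_syntax

section \<open>Congruences modulo powers of the variable, and units of C[[x, y]]\<close>

lemma X_power_dvd_iff: "fps_X ^ n dvd (f :: complex fps) \<longleftrightarrow> (\<forall>k<n. f $ k = 0)"
proof
  assume "fps_X ^ n dvd f"
  then obtain g where "f = fps_X ^ n * g" by (auto elim: dvdE)
  then show "\<forall>k<n. f $ k = 0" by (auto simp: fps_X_power_mult_nth)
next
  assume *: "\<forall>k<n. f $ k = 0"
  have "f = fps_X ^ n * fps_shift n f"
    by (rule fps_ext) (use * in \<open>auto simp: fps_X_power_mult_nth\<close>)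
  then show "fps_X ^ n dvd f" by (metis dvd_triv_left)
qed

lemma X_power_dvd_power: "h $ 0 = 0 \<Longrightarrow> fps_X ^ n dvd (h :: complex fps) ^ n"
  using X_power_dvd_iff[of 1 h] by (simp add: dvd_power_same)

lemma eq_if_X_power_dvd:
  assumes "\<And>N. fps_X ^ Suc N dvd (a - b :: complex fps)"
  shows "a = b"
  using assms by (intro fps_ext) (force simp: X_power_dvd_iff simp del: power_Suc)

text \<open>Inversion takes place twice: in C[[x]], whose scalars form a field, and then over
  C[[x]], where only an invertible constant coefficient is available.\<close>

lemma series2_is_unit_iff: "(F :: series2) dvd 1 \<longleftrightarrow> F $ 0 $ 0 \<noteq> 0"
proof
  assume "F dvd 1"
  then obtain G where "1 = F * G" by (auto elim: dvdE)
  then have "F $ 0 * G $ 0 = 1" by (metis fps_mult_nth_0 fps_one_nth zero_neq_one)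
  then have "F $ 0 $ 0 * G $ 0 $ 0 = 1" by (metis fps_mult_nth_0 fps_one_nth zero_neq_one)
  then show "F $ 0 $ 0 \<noteq> 0" by auto
next
  assume "F $ 0 $ 0 \<noteq> 0"
  then have "F $ 0 * inverse (F $ 0) = 1" by (simp add: inverse_mult_eq_1')
  then have "F * fps_right_inverse F (inverse (F $ 0)) = 1" by (rule fps_right_inverse)
  then show "F dvd 1" by (metis dvd_triv_left)
qed

subsection \<open>Substituting a series in x for y\<close>

text \<open>
  The series F(x, h(x)) for h(0) = 0; then the terms with \<open>j > k\<close> do not contribute to the
  coefficient k.
\<close>

definition ev :: "complex fps \<Rightarrow> series2 \<Rightarrow> complex fps" where
  "ev h F = Abs_fps (\<lambda>k. (\<Sum>j\<le>k. F $ j * h ^ j) $ k)"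

text \<open>The working form of convergence: h^j is divisible by X^j, so the terms up to N determine
  the value modulo X^(N+1).\<close>

lemma ev_truncate:
  assumes "h $ 0 = 0"
  shows "fps_X ^ Suc N dvd ev h F - (\<Sum>j\<le>N. F $ j * h ^ j)"
  unfolding X_power_dvd_iff
proof safe
  fix k assume "k < Suc N"
  have "(F $ j * h ^ j) $ k = 0" if "j > k" for j
  proof -
    have "fps_X ^ j dvd F $ j * h ^ j" using assms by (intro dvd_mult X_power_dvd_power)
    then show ?thesis using that by (simp add: X_power_dvd_iff)
  qed
  then have "(\<Sum>j\<le>N. (F $ j * h ^ j) $ k) = (\<Sum>j\<le>k. (F $ j * h ^ j) $ k)"
    using \<open>k < Suc N\<close> by (intro sum.mono_neutral_right) auto
  then show "(ev h F - (\<Sum>j\<le>N. F $ j * h ^ j)) $ k = 0"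
    by (simp add: ev_def fps_sum_nth)
qed

lemma ev_eqI:
  assumes "h $ 0 = 0" "\<And>N. fps_X ^ Suc N dvd (\<Sum>j\<le>N. F $ j * h ^ j) - r"
  shows "ev h F = r"
proof (rule eq_if_X_power_dvd)
  fix N
  show "fps_X ^ Suc N dvd ev h F - r"
    using dvd_add[OF ev_truncate[OF assms(1), of N F] assms(2)[of N]] by simp
qed

text \<open>Identifies \<open>ev\<close> with the X-adic limit that occurs in the definition of
  Newton-Puiseux roots.\<close>

lemma ev_sums:
  assumes "h $ 0 = 0"
  shows "(\<lambda>j. F $ j * h ^ j) sums ev h F"
  unfolding sums_def
proof (rule tendsto_fpsI)
  fix k
  have "(\<Sum>j<N. F $ j * h ^ j) $ k = ev h F $ k" if "N \<ge> Suc k" for N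
    using that ev_truncate[OF assms, of "N - 1" F] unfolding X_power_dvd_iff
    by (cases N) (auto simp: lessThan_Suc_atMost)
  then show "\<forall>\<^sub>F N in sequentially. (\<Sum>j<N. F $ j * h ^ j) $ k = ev h F $ k"
    by (rule eventually_mono[OF eventually_ge_at_top])
qed

lemma ev_sums_iff: "h $ 0 = 0 \<Longrightarrow> (\<lambda>j. F $ j * h ^ j) sums r \<longleftrightarrow> ev h F = r"
  using ev_sums sums_unique2 by metis

lemma ev_nth_0 [simp]: "ev h F $ 0 = F $ 0 $ 0"
  by (simp add: ev_def)

lemma ev_add: "ev h (F + G) = ev h F + ev h G"
  by (rule fps_ext) (simp add: ev_def algebra_simps sum.distrib fps_sum_nth)

lemma ev_const [simp]: "h $ 0 = 0 \<Longrightarrow> ev h (fps_const r) = r"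
proof (erule ev_eqI)
  fix N
  have "(\<Sum>j\<le>N. fps_const r $ j * h ^ j) = (\<Sum>j\<in>{0}. fps_const r $ j * h ^ j)"
    by (rule sum.mono_neutral_right) auto
  then show "fps_X ^ Suc N dvd (\<Sum>j\<le>N. fps_const r $ j * h ^ j) - r" by simp
qed

text \<open>The partial sums telescope to the single term - S_N h^(N+1), which tends to 0.\<close>

lemma ev_linear_factor_mult:
  assumes "h $ 0 = 0"
  shows "ev h ((fps_X - fps_const h) * S) = 0"
proof (rule ev_eqI[OF assms])
  fix N
  have "(\<Sum>j\<le>N. ((fps_X - fps_const h) * S) $ j * h ^ j) = - S $ N * h ^ Suc N"
    by (induction N) (simp_all add: algebra_simps)
  then show "fps_X ^ Suc N dvd (\<Sum>j\<le>N. ((fps_X - fps_const h) * S) $ j * h ^ j) - 0"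
    using X_power_dvd_power[OF assms, of "Suc N"] by (simp add: dvd_mult del: power_Suc)
qed

lemma ev_unique:
  assumes "h $ 0 = 0" "F = (fps_X - fps_const h) * Q + fps_const r"
  shows "ev h F = r"
  using assms by (simp add: ev_add ev_linear_factor_mult)

text \<open>One step of the Horner scheme.\<close>

lemma ev_shift:
  assumes "h $ 0 = 0"
  shows "ev h F = F $ 0 + h * ev h (fps_shift 1 F)"
proof (rule ev_eqI[OF assms])
  fix N
  let ?G = "fps_shift 1 F"
  have eq: "(\<Sum>j\<le>Suc N. F $ j * h ^ j) = F $ 0 + h * (\<Sum>j\<le>N. ?G $ j * h ^ j)"
    by (simp only: sum.atMost_Suc_shift) (simp add: sum_distrib_left algebra_simps)
  have "(\<Sum>j\<le>N. F $ j * h ^ j) - (F $ 0 + h * ev h ?G) =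
    - (h * (ev h ?G - (\<Sum>j\<le>N. ?G $ j * h ^ j))) - F $ Suc N * h ^ Suc N"
    using eq by (simp add: algebra_simps)
  then show "fps_X ^ Suc N dvd (\<Sum>j\<le>N. F $ j * h ^ j) - (F $ 0 + h * ev h ?G)"
    using ev_truncate[OF assms, of N ?G] X_power_dvd_power[OF assms, of "Suc N"]
    by (simp add: dvd_mult dvd_diff del: power_Suc)
qed

text \<open>Synthetic division by y - h: as in the Horner scheme, the coefficients of the quotient
  are the tails of F evaluated at h.\<close>

lemma ev_division:
  assumes "h $ 0 = 0"
  obtains Q where "F = (fps_X - fps_const h) * Q + fps_const (ev h F)"
proof
  define Q where "Q = Abs_fps (\<lambda>i. ev h (fps_shift (Suc i) F))"
  show "F = (fps_X - fps_const h) * Q + fps_const (ev h F)"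
  proof (rule fps_ext)
    fix i
    have "ev h (fps_shift i F) = F $ i + h * ev h (fps_shift (Suc i) F)"
      using ev_shift[OF assms, of "fps_shift i F"]
      by (simp add: fps_shift_fps_shift[symmetric] del: fps_shift_fps_shift)
    then show "F $ i = ((fps_X - fps_const h) * Q + fps_const (ev h F)) $ i"
      by (cases i) (auto simp: Q_def algebra_simps)
  qed
qed

lemma ev_eq_0_iff: "h $ 0 = 0 \<Longrightarrow> ev h F = 0 \<longleftrightarrow> fps_X - fps_const h dvd F"
  using ev_linear_factor_mult ev_division[of h F] by (metis add_0_right dvdE dvd_triv_left fps_const_0_eq_0)

text \<open>\<open>ev h\<close> is the remainder modulo y - h, and remainders multiply; this
  replaces a rearrangement of the product of two infinite sums.\<close>

lemma ev_mult:
  assumes "h $ 0 = 0"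
  shows "ev h (F * G) = ev h F * ev h G"
proof -
  obtain Q where Q: "F = (fps_X - fps_const h) * Q + fps_const (ev h F)"
    using ev_division[OF assms] .
  obtain R where R: "G = (fps_X - fps_const h) * R + fps_const (ev h G)"
    using ev_division[OF assms] .
  have "F * G = (fps_X - fps_const h) * (Q * G) + fps_const (ev h F) * G"
    by (subst Q) (simp only: algebra_simps)
  also have "fps_const (ev h F) * G =
      (fps_X - fps_const h) * (fps_const (ev h F) * R) + fps_const (ev h F * ev h G)"
    unfolding fps_const_mult[symmetric] by (subst R) (simp only: algebra_simps)
  finally have "F * G = (fps_X - fps_const h) * (Q * G + fps_const (ev h F) * R) + fps_const (ev h F * ev h G)"
    by (simp only: algebra_simps)
  then show ?thesis by (rule ev_unique[OF assms])
qed

lemma ev_linear_factor [simp]: "h $ 0 = 0 \<Longrightarrow> ev h (fps_X - fps_const g) = h - g"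
  by (rule ev_unique[where Q = 1]) (simp_all flip: fps_const_sub)

lemma linear_factor_nonzero [simp]: "fps_X - fps_const g \<noteq> (0 :: series2)"
proof
  assume "fps_X - fps_const g = 0"
  then have "(fps_X - fps_const g) $ 1 = 0" by simp
  then show False by simp
qed

lemma ev_1 [simp]: "h $ 0 = 0 \<Longrightarrow> ev h 1 = 1"
  using ev_const[of h 1] by simp

lemma ev_prod: "h $ 0 = 0 \<Longrightarrow> ev h (\<Prod>k\<in>K. F k) = (\<Prod>k\<in>K. ev h (F k))"
  by (induction K rule: infinite_finite_induct) (auto simp: ev_mult)

text \<open>As C[[x]] is a domain, splitting off one linear factor leaves the other, different roots
  as roots of the quotient.\<close>

lemma linear_factors_prod_dvd:
  assumes "finite K" "\<And>k. k \<in> K \<Longrightarrow> h k $ 0 = 0" "\<And>k. k \<in> K \<Longrightarrow> ev (h k) F = 0" "inj_on h K"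
  shows "(\<Prod>k\<in>K. fps_X - fps_const (h k)) dvd F"
  using assms
proof (induction K arbitrary: F rule: finite_induct)
  case (insert a K)
  obtain Q where Q: "F = (fps_X - fps_const (h a)) * Q"
    using insert.prems ev_eq_0_iff[of "h a" F] by (auto elim: dvdE)
  have "ev (h k) Q = 0" if "k \<in> K" for k
  proof -
    have "(h k - h a) * ev (h k) Q = 0"
      using that insert.prems(1,2)[of k] by (simp add: Q ev_mult)
    moreover have "h k \<noteq> h a" using that insert by (auto simp: inj_on_def)
    ultimately show ?thesis by simp
  qed
  then have "(\<Prod>k\<in>K. fps_X - fps_const (h k)) dvd Q"
    using insert by (auto simp: inj_on_def)
  then show ?case using insert.hyps by (simp add: Q mult_dvd_mono)
qed simp

subsection \<open>Substituting a series for x\<close>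

text \<open>Two substitutions matter: \<open>fps_X ^ n\<close>, which turns exponents with
  denominator n into integers, and the multiplication of x by a root of unity, which is the Galois
  action.\<close>

definition base_change :: "complex fps \<Rightarrow> series2 \<Rightarrow> series2" where
  "base_change g F = Abs_fps (\<lambda>j. F $ j oo g)"

lemma base_change_nth [simp]: "base_change g F $ j = F $ j oo g"
  by (simp add: base_change_def)

lemma base_change_add: "base_change g (F + G) = base_change g F + base_change g G"
  by (rule fps_ext) (simp add: fps_compose_add_distrib)

lemma base_change_diff: "base_change g (F - G) = base_change g F - base_change g G"
  by (rule fps_ext) (simp add: fps_compose_sub_distrib)

lemma base_change_mult: "g $ 0 = 0 \<Longrightarrow> base_change g (F * G) = base_change g F * base_change g G"
  by (rule fps_ext)
    (simp add: fps_mult_nth fps_compose_sum_distrib fps_compose_mult_distrib)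

lemma base_change_const [simp]: "base_change g (fps_const r) = fps_const (r oo g)"
  by (rule fps_ext) (auto simp: fps_compose_0)

lemma base_change_X [simp]: "base_change g fps_X = fps_X"
  by (rule fps_ext) (simp add: fps_X_def)

lemma base_change_1 [simp]: "base_change g 1 = 1"
  by (rule fps_ext) simp

lemma base_change_0 [simp]: "base_change g 0 = 0"
  by (rule fps_ext) simp

lemma base_change_prod:
  "g $ 0 = 0 \<Longrightarrow> base_change g (\<Prod>k\<in>K. F k) = (\<Prod>k\<in>K. base_change g (F k))"
  by (induction K rule: infinite_finite_induct) (auto simp: base_change_mult)

lemma base_change_base_change:
  "g $ 0 = 0 \<Longrightarrow> g' $ 0 = 0 \<Longrightarrow> base_change g (base_change g' F) = base_change (g' oo g) F"
  by (rule fps_ext) (simp add: fps_compose_assoc)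

lemma base_change_eq_iff:
  assumes "g $ 0 = 0" "g \<noteq> 0"
  shows "base_change g F = base_change g G \<longleftrightarrow> F = G"
proof
  assume "base_change g F = base_change g G"
  then have "(F $ j - G $ j) oo g = 0" for j
    by (metis base_change_nth fps_compose_sub_distrib right_minus_eq)
  then have "F $ j - G $ j = 0" for j
    using assms by (simp add: fps_compose_eq_0_iff)
  then show "F = G" by (intro fps_ext) simp
qed simp

text \<open>The substitution maps a division by y - h to a division by y - h(g), and the remainder
  is unique.\<close>

lemma ev_base_change:
  assumes "h $ 0 = 0" "g $ 0 = 0"
  shows "ev (h oo g) (base_change g F) = ev h F oo g"
proof -
  obtain Q where Q: "F = (fps_X - fps_const h) * Q + fps_const (ev h F)"
    using ev_division[OF assms(1)] .
  have "base_change g F = (fps_X - fps_const (h oo g)) * base_change g Q + fps_const (ev h F oo g)"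
    by (subst Q) (simp add: base_change_add base_change_mult base_change_diff assms)
  then show ?thesis using assms by (intro ev_unique) auto
qed

lemma fps_compose_X_power_nth:
  assumes "n > 0"
  shows "((f :: complex fps) oo fps_X ^ n) $ k = (if n dvd k then f $ (k div n) else 0)"
proof -
  have "(f oo fps_X ^ n) $ k = (\<Sum>i=0..k. if k = n * i then f $ i else 0)"
    by (simp add: fps_compose_nth power_mult[symmetric] if_distrib cong: if_cong)
  also have "\<dots> = (\<Sum>i=0..k. if i = k div n \<and> n dvd k then f $ i else 0)"
    using assms by (intro sum.cong) auto
  also have "\<dots> = (if n dvd k then f $ (k div n) else 0)"
    by (auto simp: sum.delta)
  finally show ?thesis .
qed

lemma X_power_compose: "g $ 0 = 0 \<Longrightarrow> fps_X ^ n oo (g :: complex fps) = g ^ n"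
  by (metis fps_X_fps_compose_startby0 fps_compose_power)

subsection \<open>Taylor expansion and the Newton-Puiseux theorem\<close>

text \<open>The divided derivative (1/i!) d^i/dy^i, that is, the i-th Taylor coefficient in
  y.\<close>

definition hasse :: "nat \<Rightarrow> series2 \<Rightarrow> series2" where
  "hasse i F = Abs_fps (\<lambda>j. of_nat ((i + j) choose i) * F $ (i + j))"

text \<open>This is F(x, b + y).\<close>

definition translate :: "complex fps \<Rightarrow> series2 \<Rightarrow> series2" where
  "translate b F = Abs_fps (\<lambda>i. ev b (hasse i F))"

lemma hasse_nth [simp]: "hasse i F $ j = of_nat ((i + j) choose i) * F $ (i + j)"
  by (simp add: hasse_def)

lemma translate_nth: "translate b F $ i = ev b (hasse i F)"
  by (simp add: translate_def)

lemma translate_nth_0 [simp]: "translate b F $ 0 = ev b F"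
  by (simp add: translate_nth hasse_def fps_nth_inverse)

lemma translate_nth_nth_0 [simp]: "translate b F $ i $ 0 = F $ i $ 0"
  by (simp add: translate_nth)

text \<open>Modulo X^(N+1) both sides are finite sums over i + j \<le> N; grouping by m = i + j, the
  binomial theorem turns one into the other.\<close>

lemma ev_translate:
  assumes b: "b $ 0 = 0" and h: "h $ 0 = 0"
  shows "ev h (translate b F) = ev (b + h) F"
proof (rule ev_eqI[OF h])
  fix N
  define T where "T = (\<lambda>i j. of_nat ((i + j) choose i) * F $ (i + j) * b ^ j * h ^ i)"
  \<comment> \<open>The factor h^i already contributes X^i, so the inner sum may stop at N - i. This
    makes the index set the triangle i + j \<le> N.\<close>
  have "fps_X ^ Suc N dvd ev b (hasse i F) * h ^ i - (\<Sum>j\<le>N - i. T i j)" if "i \<le> N" for i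
  proof -
    have "fps_X ^ Suc (N - i) * fps_X ^ i dvd
        (ev b (hasse i F) - (\<Sum>j\<le>N - i. hasse i F $ j * b ^ j)) * h ^ i"
      by (intro mult_dvd_mono ev_truncate b X_power_dvd_power h)
    moreover have "fps_X ^ Suc (N - i) * fps_X ^ i = (fps_X ^ Suc N :: complex fps)"
      using that by (simp flip: power_add power_Suc)
    moreover have "(ev b (hasse i F) - (\<Sum>j\<le>N - i. hasse i F $ j * b ^ j)) * h ^ i
        = ev b (hasse i F) * h ^ i - (\<Sum>j\<le>N - i. T i j)"
      by (simp add: T_def algebra_simps sum_distrib_left sum_distrib_right)
    ultimately show ?thesis by metis
  qed
  then have "fps_X ^ Suc N dvd (\<Sum>i\<le>N. ev b (hasse i F) * h ^ i - (\<Sum>j\<le>N - i. T i j))"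
    by (intro dvd_sum) simp
  moreover have "(\<Sum>i\<le>N. \<Sum>j\<le>N - i. T i j) = (\<Sum>m\<le>N. F $ m * (b + h) ^ m)"
  proof -
    have "(\<Sum>i\<le>N. \<Sum>j\<le>N - i. T i j) = (\<Sum>(i, j)\<in>(SIGMA i:{..N}. {..N - i}). T i j)"
      by (rule sum.Sigma) auto
    also have "(SIGMA i:{..N}. {..N - i}) = {(i, j). i + j \<le> N}" by auto
    also have "(\<Sum>(i, j)\<in>{(i, j). i + j \<le> N}. T i j) = (\<Sum>m\<le>N. \<Sum>i\<le>m. T i (m - i))"
      by (rule sum.triangle_reindex_eq)
    also have "\<dots> = (\<Sum>m\<le>N. F $ m * (b + h) ^ m)"
    proof (rule sum.cong[OF refl])
      fix m
      have "(\<Sum>i\<le>m. T i (m - i)) = (\<Sum>i\<le>m. F $ m * (of_nat (m choose i) * h ^ i * b ^ (m - i)))"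
        by (intro sum.cong) (auto simp: T_def algebra_simps)
      then show "(\<Sum>i\<le>m. T i (m - i)) = F $ m * (b + h) ^ m"
        by (simp add: add.commute[of b h] binomial_ring sum_distrib_left)
    qed
    finally show ?thesis .
  qed
  ultimately have "fps_X ^ Suc N dvd (\<Sum>i\<le>N. translate b F $ i * h ^ i) - (\<Sum>m\<le>N. F $ m * (b + h) ^ m)"
    by (simp add: sum_subtractf translate_nth)
  moreover have "fps_X ^ Suc N dvd ev (b + h) F - (\<Sum>m\<le>N. F $ m * (b + h) ^ m)"
    using b h by (intro ev_truncate) simp
  ultimately show "fps_X ^ Suc N dvd (\<Sum>i\<le>N. translate b F $ i * h ^ i) - ev (b + h) F"
    using dvd_diff[of "fps_X ^ Suc N"] by (metis (no_types, lifting) diff_diff_eq2 diff_add_cancel)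
qed

lemma base_change_translate:
  assumes "b $ 0 = 0" "g $ 0 = 0"
  shows "base_change g (translate b F) = translate (b oo g) (base_change g F)"
proof (rule fps_ext)
  fix i
  have "base_change g (hasse i F) = hasse i (base_change g F)"
    by (rule fps_ext) (simp add: fps_compose_mult_distrib assms flip: fps_of_nat)
  then show "base_change g (translate b F) $ i = translate (b oo g) (base_change g F) $ i"
    using ev_base_change[OF assms, of "hasse i F"] by (simp add: translate_nth)
qed

lemma ev_cong_X_power:
  assumes "b $ 0 = 0" "b' $ 0 = 0" "fps_X ^ M dvd b - b'"
  shows "fps_X ^ M dvd ev b F - ev b' F"
proof -
  have "ev b F = ev (b - b') (translate b' F)"
    using assms by (simp add: ev_translate)
  also have "\<dots> = ev b' F + (b - b') * ev (b - b') (fps_shift 1 (translate b' F))"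
    using assms ev_shift[of "b - b'" "translate b' F"] by simp
  finally show ?thesis using assms(3) by simp
qed

text \<open>Hensel lifting: the root is built one coefficient at a time, each being fixed by a
  linear equation whose leading coefficient is the nonzero value of dF/dy at the origin.\<close>

lemma smooth_root:
  assumes "F $ 0 $ 0 = 0" "F $ 1 $ 0 \<noteq> 0"
  obtains b where "b $ 0 = 0" "ev b F = 0"
proof -
  define P where "P = (\<lambda>N b. b $ 0 = 0 \<and> fps_X ^ Suc N dvd ev b F)"
  have step: "\<exists>b'. P (Suc N) b' \<and> fps_X ^ Suc N dvd b' - b" if "P N b" for N b
  proof -
    \<comment> \<open>In the Taylor expansion at b, the increment c x^(N+1) changes the coefficient
      N+1 of the value by c times \<open>F $ 1 $ 0\<close>, and no lower one.\<close>
    define c where "c = - (ev b F $ Suc N) / F $ 1 $ 0"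
    define h where "h = fps_const c * fps_X ^ Suc N"
    define E where "E = ev h (fps_shift 1 (translate b F))"
    have h0: "h $ 0 = 0" and b0: "b $ 0 = 0" using that by (auto simp: h_def P_def)
    have hA: "(h * A) $ k = (if k \<le> N then 0 else c * A $ (k - Suc N))" for A k
      unfolding h_def mult.assoc by (auto simp: fps_X_power_mult_nth simp del: power_Suc)
    have "ev (b + h) F = ev b F + h * E"
      using ev_translate[OF b0 h0, of F, symmetric] ev_shift[OF h0, of "translate b F"] by (simp add: E_def)
    moreover have "E $ 0 = F $ 1 $ 0" by (simp add: E_def)
    ultimately have "ev (b + h) F $ k = 0" if "k < Suc (Suc N)" for k
      using that \<open>P N b\<close> assms(2) unfolding P_def X_power_dvd_iff
      by (cases "k = Suc N") (auto simp: hA c_def)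
    then have "P (Suc N) (b + h)" using h0 b0 by (simp add: P_def X_power_dvd_iff del: power_Suc)
    then show ?thesis by (intro exI[of _ "b + h"]) (simp add: h_def)
  qed
  have "P 0 0" using assms(1) by (simp add: P_def X_power_dvd_iff[of 1, simplified])
  then obtain s where s: "\<And>N. P N (s N)" "\<And>N. fps_X ^ Suc N dvd s (Suc N) - s N"
    using dependent_nat_choice[of P "\<lambda>N b b'. fps_X ^ Suc N dvd b' - b"] step by blast
  have stable: "s (k + m) $ k = s k $ k" for k m
  proof (induction m)
    case (Suc m)
    have "s (Suc (k + m)) $ k = s (k + m) $ k"
      using s(2)[of "k + m"] unfolding X_power_dvd_iff by simp
    then show ?case using Suc by simp
  qed simp
  \<comment> \<open>The limit of the approximations: the coefficient k no longer changes from
    \<open>s k\<close> on.\<close>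
  define b where "b = Abs_fps (\<lambda>k. s k $ k)"
  have b0: "b $ 0 = 0" using s(1)[of 0] by (simp add: b_def P_def)
  have close: "fps_X ^ Suc N dvd b - s N" for N
    unfolding X_power_dvd_iff
  proof safe
    fix k assume "k < Suc N"
    then show "(b - s N) $ k = 0" using stable[of k "N - k"] by (simp add: b_def)
  qed
  have "ev b F = 0"
  proof (rule eq_if_X_power_dvd)
    fix N
    have "fps_X ^ Suc N dvd ev b F - ev (s N) F" "fps_X ^ Suc N dvd ev (s N) F"
      using ev_cong_X_power[OF b0 _ close] s(1)[of N] by (auto simp: P_def)
    then show "fps_X ^ Suc N dvd ev b F - 0" using dvd_add by (metis diff_add_cancel diff_zero)
  qed
  then show thesis using that b0 by blast
qed

text \<open>With two different monomials, P is not a constant times a power of the variable; so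
  removing the zero root leaves a nonconstant polynomial.\<close>

lemma nonzero_complex_root:
  fixes P :: "complex poly"
  assumes "coeff P i \<noteq> 0" "coeff P j \<noteq> 0" "i \<noteq> j"
  obtains c where "c \<noteq> 0" "poly P c = 0"
proof -
  have "P \<noteq> 0" using assms by auto
  from order_decomp[OF this, of 0] obtain q where
    q: "P = [:0, 1:] ^ order 0 P * q" "\<not> [:0, 1:] dvd q" by auto
  have "\<not> constant (poly q)"
  proof
    assume "constant (poly q)"
    then have "degree q = 0" by (simp add: constant_degree)
    then obtain a where "q = [:a:]" by (rule degree_eq_zeroE)
    then have "P = monom a (order 0 P)" using q(1) by (simp add: monom_altdef)
    then have "coeff P k \<noteq> 0 \<Longrightarrow> k = order 0 P" for k by (metis coeff_monom)
    then show False using assms by metis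
  qed
  then obtain c where c: "poly q c = 0" using fundamental_theorem_of_algebra by blast
  then have "c \<noteq> 0" using q(2) by (metis minus_zero poly_eq_0_iff_dvd)
  moreover have "poly P c = 0" by (subst q(1)) (simp add: c)
  ultimately show thesis using that by blast
qed

text \<open>p/q is the inverse slope of the edge of the Newton polygon that ends in (0, d): the
  least value of (order of \<open>F $ j\<close>)/(d - j), attained at j0. After x = s^q, all points
  lie on or beyond the line of weight p * d, where s has weight 1 and y has weight p. The fraction
  p/q need not be reduced.\<close>

lemma initial_slope:
  assumes "\<And>j. j < d \<Longrightarrow> F $ j $ 0 = 0" "F $ 0 \<noteq> 0" "(d::nat) > 0"
  obtains p q j0 where "p > 0" "j0 < d" "q = d - j0" "F $ j0 $ p \<noteq> (0 :: complex)"
    "\<And>j. j \<le> d \<Longrightarrow> fps_X ^ (p * (d - j)) dvd F $ j oo fps_X ^ q"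
proof -
  define J where "J = {j. j < d \<and> F $ j \<noteq> 0}"
  define r where "r = (\<lambda>j. real (subdegree (F $ j)) / real (d - j))"
  have "finite J" "0 \<in> J" using assms by (auto simp: J_def)
  then obtain j0 where j0: "j0 \<in> J" "\<And>j. j \<in> J \<Longrightarrow> r j0 \<le> r j"
    using arg_min_if_finite[of J r] by (metis emptyE linorder_not_less)
  define p where "p = subdegree (F $ j0)"
  have "F $ j0 \<noteq> 0" "j0 < d" using j0 by (auto simp: J_def)
  then have 1: "F $ j0 $ p \<noteq> 0" by (simp add: p_def)
  then have "p > 0" using assms(1)[OF \<open>j0 < d\<close>] by (metis gr0I)
  have "fps_X ^ (p * (d - j)) dvd F $ j oo fps_X ^ (d - j0)" if "j \<le> d" for j
    unfolding X_power_dvd_iff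
  proof safe
    fix k assume k: "k < p * (d - j)"
    then have "j < d" by (metis diff_is_0_eq less_nat_zero_code linorder_not_less mult_0_right)
    show "(F $ j oo fps_X ^ (d - j0)) $ k = 0"
    proof (rule ccontr)
      assume "\<not> ?thesis"
      then have nz: "d - j0 dvd k" "F $ j $ (k div (d - j0)) \<noteq> 0"
        using \<open>j0 < d\<close> by (auto simp: fps_compose_X_power_nth split: if_splits)
      then have "j \<in> J" using \<open>j < d\<close> by (auto simp: J_def)
      have "subdegree (F $ j) \<le> k div (d - j0)" using nz(2) by (rule subdegree_leI)
      then have "subdegree (F $ j) * (d - j0) \<le> k"
        using nz(1) by (metis dvd_div_mult_self mult_le_mono1)
      moreover have "p * (d - j) \<le> subdegree (F $ j) * (d - j0)"
      proof -
        have "real p / real (d - j0) \<le> real (subdegree (F $ j)) / real (d - j)"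
          using j0(2)[OF \<open>j \<in> J\<close>] by (simp add: r_def p_def)
        then have "real p * real (d - j) \<le> real (subdegree (F $ j)) * real (d - j0)"
          using \<open>j0 < d\<close> \<open>j < d\<close> by (simp add: divide_simps mult.commute)
        then show ?thesis by (metis of_nat_le_iff of_nat_mult)
      qed
      ultimately show False using k by simp
    qed
  qed
  then show thesis using that[OF \<open>p > 0\<close> \<open>j0 < d\<close> refl 1] by blast
qed

text \<open>
  The Tschirnhaus translation removes the term of degree \<open>d - 1\<close> in y; then the initial
  polynomial along the steepest edge has a nonzero root c, of multiplicity less than d, and the
  substitution \<open>x = s^q\<close>, \<open>y = s^p (c + z)\<close> decreases d.
\<close>

theorem newton_puiseux:
  assumes "\<And>j. j < d \<Longrightarrow> F $ j $ 0 = 0" "F $ d $ 0 \<noteq> 0" "d > 0"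
  shows "\<exists>n h. n > 0 \<and> h $ 0 = 0 \<and> ev h (base_change (fps_X ^ n) F) = 0"
  using assms
proof (induction d arbitrary: F rule: less_induct)
  case (less d)
  have base1: "base_change (fps_X ^ 1) F = F" by (rule fps_ext) simp
  \<comment> \<open>F is a series in y, so the shift is not read off from two coefficients. It is a
    root of the divided derivative of order d - 1, whose linear coefficient is d times
    \<open>F $ d\<close> and hence nonzero at x = 0.\<close>
  obtain b where b: "b $ 0 = 0" "ev b (hasse (d - 1) F) = 0"
  proof (rule smooth_root)
    show "hasse (d - 1) F $ 0 $ 0 = 0" using less.prems by simp
    have "d choose (d - 1) = d" using less.prems(3) by (cases d) auto
    then show "hasse (d - 1) F $ 1 $ 0 \<noteq> 0" using less.prems by (simp flip: fps_of_nat)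
  qed
  define F1 where "F1 = translate b F"
  have F1: "F1 $ (d - 1) = 0" "\<And>j. F1 $ j $ 0 = F $ j $ 0" "F1 $ 0 = ev b F"
    using b(2) by (simp_all only: F1_def translate_nth_nth_0 translate_nth_0) (simp only: translate_nth)
  show ?case
  proof (cases "F1 $ 0 = 0")
    case True
    then show ?thesis using b(1) base1 F1(3) by (intro exI[of _ 1] exI[of _ b]) simp
  next
    case False
    obtain p q j0 where pq: "p > 0" "j0 < d" "q = d - j0" "F1 $ j0 $ p \<noteq> 0"
      "\<And>j. j \<le> d \<Longrightarrow> fps_X ^ (p * (d - j)) dvd F1 $ j oo fps_X ^ q"
      by (rule initial_slope[of d F1]) (use less.prems F1 False in auto)
    have "q > 0" using pq by simp
    have "d > 1" using False F1(1) less.prems(3) by (metis One_nat_def Suc_lessI diff_Suc_1)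
    define F2 where "F2 = base_change (fps_X ^ q) F1"
    have F2_low: "F2 $ j $ k = 0" if "j \<le> d" "k < p * (d - j)" for j k
      using pq(5)[OF that(1)] that(2) by (simp add: F2_def X_power_dvd_iff)
    \<comment> \<open>The coefficients of the initial form, that is, of the terms on the edge after
      x = s^q.\<close>
    define \<alpha> where "\<alpha> = (\<lambda>j. F2 $ j $ (p * (d - j)))"
    have \<alpha>: "\<alpha> d \<noteq> 0" "\<alpha> (d - 1) = 0" "\<alpha> j0 \<noteq> 0"
      using less.prems(2) F1(1,2) pq \<open>q > 0\<close> by (simp_all add: \<alpha>_def F2_def fps_compose_X_power_nth)
    obtain c where c: "c \<noteq> 0" "(\<Sum>j\<le>d. \<alpha> j * c ^ j) = 0"
    proof -
      have co: "coeff (\<Sum>j\<le>d. monom (\<alpha> j) j) i = \<alpha> i" if "i \<le> d" for i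
        using that by (simp add: coeff_sum)
      obtain c where "c \<noteq> 0" "poly (\<Sum>j\<le>d. monom (\<alpha> j) j) c = 0"
        by (rule nonzero_complex_root[of _ d j0]) (use \<alpha> co pq in auto)
      then show thesis using that by (simp add: poly_sum poly_monom)
    qed
    define B where "B = fps_const c * fps_X ^ p"
    have B0: "B $ 0 = 0" using pq by (simp add: B_def)
    have Bpow: "(f * B ^ j) $ i = (if p * j \<le> i then c ^ j * f $ (i - p * j) else 0)" for f j i
    proof -
      have "f * B ^ j = fps_const (c ^ j) * (fps_X ^ (p * j) * f)"
        by (simp add: B_def power_mult_distrib power_mult fps_const_power)
      then show ?thesis by (simp only: fps_mult_left_const_nth fps_X_power_mult_nth) simp
    qed
    define F3 where "F3 = translate B F2"
    have F3: "F3 $ k $ i = (\<Sum>j\<le>d - k. (hasse k F2 $ j * B ^ j) $ i)"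
      if "k \<le> d" "i \<le> p * (d - k)" for k i
    proof -
      \<comment> \<open>Reconciles two truncations: \<open>ev\<close> stops at j = i, the weight
        argument at j = d - k. In the range considered, B^j has order p * j > i beyond either
        bound.\<close>
      have z: "(hasse k F2 $ j * B ^ j) $ i = 0" if "j > i \<or> j > d - k" for j
      proof -
        have "p * j > i"
        proof (cases "j > i")
          case True
          moreover have "j \<le> p * j" using pq(1) by simp
          ultimately show ?thesis by linarith
        next
          case False
          then have "p * j > p * (d - k)" using that pq(1) by simp
          then show ?thesis using \<open>i \<le> p * (d - k)\<close> by linarith
        qed
        then show ?thesis by (simp add: Bpow)
      qed
      have "F3 $ k $ i = (\<Sum>j\<le>i. (hasse k F2 $ j * B ^ j) $ i)"
        by (simp add: F3_def translate_nth ev_def fps_sum_nth)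
      also have "\<dots> = (\<Sum>j\<le>i + d. (hasse k F2 $ j * B ^ j) $ i)"
        by (rule sum.mono_neutral_left) (use z in auto)
      also have "\<dots> = (\<Sum>j\<le>d - k. (hasse k F2 $ j * B ^ j) $ i)"
        by (rule sum.mono_neutral_right) (use z in auto)
      finally show ?thesis .
    qed
    have F3_low: "F3 $ k $ i = 0" if "k \<le> d" "i < p * (d - k)" for k i
    proof -
      have "(hasse k F2 $ j * B ^ j) $ i = 0" if "j \<le> d - k" for j
      proof (cases "p * j \<le> i")
        case True
        have "p * (d - k) = p * (d - (k + j)) + p * j"
          using le_add_diff_inverse2[OF that] by (metis diff_diff_left distrib_left)
        then have "F2 $ (k + j) $ (i - p * j) = 0"
          using \<open>k \<le> d\<close> that \<open>i < p * (d - k)\<close> True by (intro F2_low) auto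
        then show ?thesis by (simp add: Bpow flip: fps_of_nat)
      qed (simp add: Bpow)
      then show ?thesis using F3[of k i] that by simp
    qed
    have F3_lead: "F3 $ k $ (p * (d - k)) = (\<Sum>j\<le>d - k. of_nat (k + j choose k) * c ^ j * \<alpha> (k + j))"
      if "k \<le> d" for k
    proof -
      have "(hasse k F2 $ j * B ^ j) $ (p * (d - k)) = of_nat (k + j choose k) * c ^ j * \<alpha> (k + j)"
        if "j \<le> d - k" for j
      proof -
        have "p * (d - k) - p * j = p * (d - (k + j))"
          by (simp flip: diff_mult_distrib2)
        then show ?thesis using that \<open>k \<le> d\<close> by (simp add: Bpow \<alpha>_def flip: fps_of_nat)
      qed
      then show ?thesis using F3[of k "p * (d - k)"] that by simp
    qed
    \<comment> \<open>F4 is determined by F3(s, s^p z) = s^(p d) F4(s, z): in degree k one divides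
      by a power of s if k \<le> d and multiplies by one otherwise.\<close>
    define F4 where "F4 = Abs_fps (\<lambda>k. if k \<le> d then fps_shift (p * (d - k)) (F3 $ k)
      else fps_X ^ (p * (k - d)) * F3 $ k)"
    have F34: "fps_X ^ (p * k) * F3 $ k = fps_X ^ (p * d) * F4 $ k" for k
    proof (cases "k \<le> d")
      case True
      have "F3 $ k = fps_X ^ (p * (d - k)) * F4 $ k"
        by (rule fps_ext) (use True F3_low in \<open>auto simp: F4_def fps_X_power_mult_nth\<close>)
      moreover have "p * k + p * (d - k) = p * d" using True by (simp flip: distrib_left)
      ultimately show ?thesis by (simp flip: power_add mult.assoc)
    next
      case False
      then have "p * d + p * (k - d) = p * k" by (simp flip: distrib_left)
      then show ?thesis using False by (simp add: F4_def flip: power_add mult.assoc)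
    qed
    have F4_0: "F4 $ 0 $ 0 = 0"
      using F3_lead[of 0] c(2) by (simp add: F4_def mult.commute)
    \<comment> \<open>Here the Tschirnhaus shift pays off: as \<alpha> (d - 1) = 0, this coefficient
      is d * c * \<alpha> d, so c is not a d-fold root and the order in z drops below d.\<close>
    have "F4 $ (d - 1) $ 0 = (\<Sum>j\<le>1. of_nat (d - 1 + j choose (d - 1)) * c ^ j * \<alpha> (d - 1 + j))"
      using F3_lead[of "d - 1"] \<open>d > 1\<close> by (simp add: F4_def)
    also have "\<dots> = of_nat (d choose (d - 1)) * c * \<alpha> d"
      using \<open>d > 1\<close> \<alpha>(2) by simp
    finally have F4_d: "F4 $ (d - 1) $ 0 \<noteq> 0" using c \<alpha> \<open>d > 1\<close> by simp
    define m where "m = (LEAST m. F4 $ m $ 0 \<noteq> 0)"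
    have m: "F4 $ m $ 0 \<noteq> 0" "\<And>j. j < m \<Longrightarrow> F4 $ j $ 0 = 0" "m \<le> d - 1"
      using LeastI[of "\<lambda>m. F4 $ m $ 0 \<noteq> 0", OF F4_d] Least_le[of "\<lambda>m. F4 $ m $ 0 \<noteq> 0", OF F4_d]
      unfolding m_def by (auto dest: not_less_Least)
    have "m < d" "m > 0" using m F4_0 \<open>d > 1\<close> by (auto intro: gr0I)
    from less.IH[OF this(1) m(2,1) this(2)] obtain n h where
      nh: "n > 0" "h $ 0 = 0" "ev h (base_change (fps_X ^ n) F4) = 0" by blast
    define X' where "X' = (fps_X ^ n :: complex fps)"
    have X'0: "X' $ 0 = 0" using nh(1) by (simp add: X'_def)
    define h3 where "h3 = X' ^ p * h"
    have h30: "h3 $ 0 = 0" using nh(2) by (simp add: h3_def)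
    have "ev h3 (base_change X' F3) = 0"
    proof (rule ev_eqI[OF h30])
      fix N
      have "(F3 $ k oo X') * h3 ^ k = X' ^ (p * d) * ((F4 $ k oo X') * h ^ k)" for k
      proof -
        have "(fps_X ^ (p * k) * F3 $ k) oo X' = (fps_X ^ (p * d) * F4 $ k) oo X'"
          by (simp add: F34)
        then have "X' ^ (p * k) * (F3 $ k oo X') = X' ^ (p * d) * (F4 $ k oo X')"
          by (simp add: fps_compose_mult_distrib X_power_compose X'0)
        then have "X' ^ (p * k) * (F3 $ k oo X') * h ^ k = X' ^ (p * d) * (F4 $ k oo X') * h ^ k"
          by simp
        moreover have "(X' ^ p) ^ k = X' ^ (p * k)" by (simp flip: power_mult)
        ultimately show ?thesis by (simp add: h3_def power_mult_distrib mult_ac)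
      qed
      then have "(\<Sum>k\<le>N. base_change X' F3 $ k * h3 ^ k) =
          X' ^ (p * d) * (\<Sum>k\<le>N. base_change X' F4 $ k * h ^ k)"
        by (simp add: sum_distrib_left)
      moreover have "fps_X ^ Suc N dvd (\<Sum>k\<le>N. base_change X' F4 $ k * h ^ k)"
        using ev_truncate[OF nh(2), of N "base_change X' F4"] nh(3)
        by (simp add: X'_def del: power_Suc)
      ultimately show "fps_X ^ Suc N dvd (\<Sum>k\<le>N. base_change X' F3 $ k * h3 ^ k) - 0"
        by simp
    qed
    then have "ev ((B oo X') + h3) (base_change X' F2) = 0"
      using B0 X'0 h30 by (simp add: F3_def base_change_translate ev_translate)
    moreover have "base_change X' F2 = base_change (fps_X ^ (n * q)) F1"
      using X'0 \<open>q > 0\<close>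
      by (simp add: F2_def base_change_base_change X_power_compose) (simp add: X'_def power_mult)
    \<comment> \<open>Undoing the substitutions with s = t^n and x = s^q, the root of F is b + c s^p
      + s^p h.\<close>
    ultimately have "ev ((b oo fps_X ^ (n * q)) + ((B oo X') + h3)) (base_change (fps_X ^ (n * q)) F) = 0"
      using B0 b(1) h30 nh(1) \<open>q > 0\<close> by (simp add: F1_def base_change_translate ev_translate)
    then show ?thesis using B0 b(1) h30 nh(1) \<open>q > 0\<close>
      by (intro exI[of _ "n * q"] exI[of _ "(b oo fps_X ^ (n * q)) + ((B oo X') + h3)"]) simp
  qed
qed

subsection \<open>Primitive parametrizations and prime elements\<close>

definition unity_root :: "nat \<Rightarrow> complex" where
  "unity_root n = exp (2 * of_real pi * \<i> / of_nat n)"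

lemma unity_root_power_eq_1_iff: "n > 0 \<Longrightarrow> unity_root n ^ k = 1 \<longleftrightarrow> n dvd k"
  using complex_root_unity_eq_1[of n k]
  by (simp add: unity_root_def algebra_simps flip: exp_of_nat_mult)

lemma unity_root_nonzero [simp]: "unity_root n \<noteq> 0"
  by (simp add: unity_root_def)

definition conjugate :: "nat \<Rightarrow> complex fps \<Rightarrow> nat \<Rightarrow> complex fps" where
  "conjugate n h k = h oo (fps_const (unity_root n ^ k) * fps_X)"

lemma conjugate_nth [simp]: "conjugate n h k $ i = unity_root n ^ (k * i) * h $ i"
  by (simp add: conjugate_def power_mult)

lemma conjugate_0 [simp]: "conjugate n h 0 = h"
  by (rule fps_ext) simp

lemma conjugate_self: "n > 0 \<Longrightarrow> conjugate n h n = h"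
  by (rule fps_ext) (simp add: unity_root_power_eq_1_iff)

lemma conjugate_rotate: "conjugate n h k oo (fps_const (unity_root n) * fps_X) = conjugate n h (Suc k)"
  by (rule fps_ext) (simp only: fps_nth_compose_linear conjugate_nth, simp add: power_add)

text \<open>
  \<open>h(x^(1/n))\<close> has n distinct conjugates; equivalently, no proper divisor of n is a common
  denominator of its exponents.
\<close>

definition primitive_param :: "nat \<Rightarrow> complex fps \<Rightarrow> bool" where
  "primitive_param n h \<longleftrightarrow> n > 0 \<and> h $ 0 = 0 \<and>
     (\<forall>k. (\<forall>i. h $ i \<noteq> 0 \<longrightarrow> n dvd k * i) \<longrightarrow> n dvd k)"

lemma conjugate_eq_iff:
  assumes "n > 0" "k \<le> l"
  shows "conjugate n h k = conjugate n h l \<longleftrightarrow> (\<forall>i. h $ i \<noteq> 0 \<longrightarrow> n dvd (l - k) * i)"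
proof -
  have "conjugate n h k $ i = conjugate n h l $ i \<longleftrightarrow> (h $ i \<noteq> 0 \<longrightarrow> n dvd (l - k) * i)" for i
  proof -
    have "l * i = (l - k) * i + k * i" using assms(2) by (simp flip: distrib_right)
    then have "conjugate n h l $ i = unity_root n ^ ((l - k) * i) * conjugate n h k $ i"
      by (simp add: power_add)
    moreover have "conjugate n h k $ i = 0 \<longleftrightarrow> h $ i = 0" by simp
    ultimately have "conjugate n h k $ i = conjugate n h l $ i \<longleftrightarrow>
        h $ i = 0 \<or> unity_root n ^ ((l - k) * i) = 1"
      by (metis mult_cancel_right1 mult_cancel_right2)
    then show ?thesis using unity_root_power_eq_1_iff[OF assms(1)] by blast
  qed
  then show ?thesis by (simp add: fps_eq_iff del: conjugate_nth)
qed

lemma inj_on_conjugate: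
  assumes "primitive_param n h"
  shows "inj_on (conjugate n h) {..<n}"
proof (rule linorder_inj_onI)
  fix k l assume kl: "k < l" "k \<in> {..<n}" "l \<in> {..<n}"
  show "conjugate n h k \<noteq> conjugate n h l"
  proof
    assume "conjugate n h k = conjugate n h l"
    moreover have "n > 0" "k \<le> l" using assms kl by (auto simp: primitive_param_def)
    ultimately have "\<forall>i. h $ i \<noteq> 0 \<longrightarrow> n dvd (l - k) * i" using conjugate_eq_iff by blast
    then have "n dvd l - k" using assms unfolding primitive_param_def by blast
    then show False using kl by (auto dest: dvd_imp_le)
  qed
qed auto

definition conjugate_product :: "nat \<Rightarrow> complex fps \<Rightarrow> series2" where
  "conjugate_product n h = (\<Prod>k<n. fps_X - fps_const (conjugate n h k))"

text \<open>Rotation permutes the factors cyclically. The shifted product runs from 1 to n; it is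
  compared with the original after multiplication by \<open>g 0\<close>, which equals
  \<open>g n\<close> and can be cancelled.\<close>

lemma conjugate_product_rotate:
  assumes "n > 0"
  shows "base_change (fps_const (unity_root n) * fps_X) (conjugate_product n h) = conjugate_product n h"
proof -
  define g where "g = (\<lambda>k. fps_X - fps_const (conjugate n h k))"
  have "base_change (fps_const (unity_root n) * fps_X) (conjugate_product n h) = (\<Prod>k<n. g (Suc k))"
    by (simp add: conjugate_product_def base_change_prod base_change_diff conjugate_rotate g_def)
  moreover have "(\<Prod>k<n. g (Suc k)) * g 0 = (\<Prod>k<n. g k) * g n"
    by (metis prod.lessThan_Suc prod.lessThan_Suc_shift mult.commute)
  moreover have "g n = g 0" by (simp add: g_def conjugate_self assms)
  moreover have "g 0 \<noteq> 0"
    by (simp add: g_def)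
  ultimately show ?thesis by (simp add: conjugate_product_def g_def)
qed

text \<open>The coefficient of x^i is multiplied by the i-th power of a primitive n-th root of
  unity, so an invariant series contains only exponents divisible by n.\<close>

lemma invariant_descends:
  assumes "n > 0" "base_change (fps_const (unity_root n) * fps_X) P = P"
  obtains G where "base_change (fps_X ^ n) G = P"
proof
  show "base_change (fps_X ^ n) (Abs_fps (\<lambda>j. Abs_fps (\<lambda>i. P $ j $ (n * i)))) = P"
  proof (intro fps_ext)
    fix j i
    have "base_change (fps_const (unity_root n) * fps_X) P $ j $ i = P $ j $ i"
      by (simp add: assms(2))
    then have "unity_root n ^ i * P $ j $ i = P $ j $ i" by simp
    then have "P $ j $ i = 0" if "\<not> n dvd i"
      using that unity_root_power_eq_1_iff[OF assms(1)] by auto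
    then show "base_change (fps_X ^ n) (Abs_fps (\<lambda>j. Abs_fps (\<lambda>i. P $ j $ (n * i)))) $ j $ i = P $ j $ i"
      by (simp add: fps_compose_X_power_nth assms(1))
  qed
qed

text \<open>The norm of y - h(x^(1/n)), descended to C[[x, y]]. For n > 0 the choice is unique
  because \<open>base_change (fps_X ^ n)\<close> is injective.\<close>

definition min_poly :: "nat \<Rightarrow> complex fps \<Rightarrow> series2" where
  "min_poly n h = (SOME G. base_change (fps_X ^ n) G = conjugate_product n h)"

lemma base_change_min_poly:
  assumes "n > 0"
  shows "base_change (fps_X ^ n) (min_poly n h) = conjugate_product n h"
  unfolding min_poly_def
  by (rule invariant_descends[OF assms conjugate_product_rotate[OF assms]]) (rule someI)

text \<open>F(t^n, y) does not change when t is multiplied by an n-th root of unity; hence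
  conjugates of roots are roots.\<close>

lemma ev_conjugate:
  assumes "n > 0" "h $ 0 = 0"
  shows "ev (conjugate n h k) (base_change (fps_X ^ n) F)
    = ev h (base_change (fps_X ^ n) F) oo (fps_const (unity_root n ^ k) * fps_X)"
proof -
  let ?g = "fps_const (unity_root n ^ k) * fps_X"
  have "(unity_root n ^ k) ^ n = (1::complex)"
    using unity_root_power_eq_1_iff[OF assms(1), of "k * n"] by (simp add: power_mult)
  then have "fps_X ^ n oo ?g = fps_X ^ n"
    by (simp add: X_power_compose power_mult_distrib fps_const_power)
  then have "base_change ?g (base_change (fps_X ^ n) F) = base_change (fps_X ^ n) F"
    using assms(1) by (simp add: base_change_base_change)
  then show ?thesis
    using ev_base_change[of h ?g "base_change (fps_X ^ n) F"] assms(2) by (simp add: conjugate_def)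
qed

text \<open>If h is a root, so are its n distinct conjugates, and \<open>conjugate_product\<close>
  divides F(t^n, y). The quotient of two invariant series is invariant, so the division descends to
  C[[x, y]].\<close>

lemma min_poly_dvd_iff:
  assumes "primitive_param n h"
  shows "min_poly n h dvd F \<longleftrightarrow> ev h (base_change (fps_X ^ n) F) = 0"
proof
  have n: "n > 0" and h0: "h $ 0 = 0" using assms by (auto simp: primitive_param_def)
  have Xn: "(fps_X ^ n :: complex fps) $ 0 = 0" "(fps_X ^ n :: complex fps) \<noteq> 0" using n by auto
  {
    assume "min_poly n h dvd F"
    then obtain Q where "F = min_poly n h * Q" by (auto elim: dvdE)
    then have "ev h (base_change (fps_X ^ n) F) =
        ev h (conjugate_product n h) * ev h (base_change (fps_X ^ n) Q)"
      by (simp add: base_change_mult Xn ev_mult h0 base_change_min_poly n)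
    moreover have "ev h (conjugate_product n h) = 0"
      using n h0 by (auto simp: conjugate_product_def ev_prod intro!: bexI[of _ 0])
    ultimately show "ev h (base_change (fps_X ^ n) F) = 0" by simp
  next
    let ?P = "conjugate_product n h"
    assume "ev h (base_change (fps_X ^ n) F) = 0"
    then have "?P dvd base_change (fps_X ^ n) F"
      unfolding conjugate_product_def
      by (intro linear_factors_prod_dvd inj_on_conjugate[OF assms]) (auto simp: h0 n ev_conjugate)
    then obtain Q where Q: "base_change (fps_X ^ n) F = ?P * Q" by (auto elim: dvdE)
    let ?g = "fps_const (unity_root n) * fps_X"
    have "fps_X ^ n oo ?g = fps_X ^ n"
      using unity_root_power_eq_1_iff[OF n, of n]
      by (simp add: X_power_compose power_mult_distrib fps_const_power)
    then have "base_change ?g (base_change (fps_X ^ n) F) = base_change (fps_X ^ n) F"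
      using n by (simp add: base_change_base_change)
    then have "?P * base_change ?g Q = ?P * Q"
      by (simp add: Q base_change_mult conjugate_product_rotate n)
    moreover have "?P \<noteq> 0"
      unfolding conjugate_product_def by simp
    ultimately have "base_change ?g Q = Q" by simp
    then obtain G where "base_change (fps_X ^ n) G = Q" using invariant_descends[OF n] by blast
    then have "base_change (fps_X ^ n) F = base_change (fps_X ^ n) (min_poly n h * G)"
      by (simp add: Q base_change_mult n base_change_min_poly)
    then have "F = min_poly n h * G" using base_change_eq_iff[OF Xn] by blast
    then show "min_poly n h dvd F" by simp
  }
qed

text \<open>The multiples of \<open>min_poly n h\<close> form the kernel of F \<mapsto> F(t^n,
  h(t)), a homomorphism into the domain C[[t]].\<close>

lemma prime_elem_min_poly:
  assumes "primitive_param n h"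
  shows "prime_elem (min_poly n h)"
proof (rule prime_elemI)
  have n: "n > 0" and h0: "h $ 0 = 0" using assms by (auto simp: primitive_param_def)
  have "conjugate_product n h \<noteq> 0"
    unfolding conjugate_product_def by simp
  then show "min_poly n h \<noteq> 0" using base_change_min_poly[OF n, of h] by auto
  show "\<not> min_poly n h dvd 1" using min_poly_dvd_iff[OF assms, of 1] h0 by simp
  show "min_poly n h dvd a \<or> min_poly n h dvd b" if "min_poly n h dvd a * b" for a b
    using that n h0 by (simp add: min_poly_dvd_iff[OF assms] base_change_mult ev_mult)
qed

lemma primitive_root_exists:
  assumes "n > 0" "h $ 0 = 0" "ev h (base_change (fps_X ^ n) F) = 0"
  shows "\<exists>n h. primitive_param n h \<and> ev h (base_change (fps_X ^ n) F) = 0"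
proof -
  define Q where "Q = (\<lambda>n. n > 0 \<and> (\<exists>h. h $ 0 = 0 \<and> ev h (base_change (fps_X ^ n) F) = 0))"
  define m where "m = (LEAST n. Q n)"
  have "Q n" using assms by (auto simp: Q_def)
  then have "Q m" unfolding m_def by (rule LeastI)
  then obtain g where g: "m > 0" "g $ 0 = 0" "ev g (base_change (fps_X ^ m) F) = 0"
    by (auto simp: Q_def)
  have "m dvd k" if k: "\<And>i. g $ i \<noteq> 0 \<Longrightarrow> m dvd k * i" for k
  proof (rule ccontr)
    assume "\<not> m dvd k"
    \<comment> \<open>Every exponent of g is a multiple of d = m / r, so g(t) = g'(t^d), while t^m =
      (t^d)^r. Thus g' is a root with denominator r < m, against the minimality of m.\<close>
    define r where "r = gcd m k"
    define d where "d = m div r"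
    have md: "m = r * d" "r > 0" "d > 0" using g(1) by (auto simp: d_def r_def div_greater_zero_iff)
    have "r < m" using \<open>\<not> m dvd k\<close> g(1) unfolding r_def
      by (metis gcd_dvd2 gcd_le1_nat le_neq_implies_less neq0_conv)
    have "d dvd i" if "g $ i \<noteq> 0" for i
    proof -
      define k' where "k' = k div r"
      have k': "k = r * k'" by (simp add: k'_def r_def)
      have "coprime d k'"
        unfolding d_def k'_def r_def using g(1) by (intro div_gcd_coprime) simp
      moreover have "d dvd k' * i" using k[OF that] md k' by (simp add: mult.assoc)
      ultimately show ?thesis by (simp add: coprime_dvd_mult_right_iff)
    qed
    then have gd: "g = Abs_fps (\<lambda>i. g $ (d * i)) oo fps_X ^ d" (is "g = ?g' oo _")
      by (intro fps_ext) (auto simp: fps_compose_X_power_nth md)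
    have "fps_X ^ r oo fps_X ^ d = (fps_X ^ d :: complex fps) ^ r"
      by (rule X_power_compose) (use md in simp)
    also have "\<dots> = fps_X ^ m" unfolding md(1) mult.commute[of r d] by (rule power_mult[symmetric])
    finally have "fps_X ^ m = fps_X ^ r oo (fps_X ^ d :: complex fps)" by (rule sym)
    then have "base_change (fps_X ^ m) F = base_change (fps_X ^ d) (base_change (fps_X ^ r) F)"
      using md by (simp add: base_change_base_change)
    then have "ev ?g' (base_change (fps_X ^ r) F) oo fps_X ^ d = 0"
      using g gd md ev_base_change[of ?g' "fps_X ^ d" "base_change (fps_X ^ r) F"] by simp
    then have "ev ?g' (base_change (fps_X ^ r) F) = 0"
      using md by (simp add: fps_compose_eq_0_iff)
    then have "Q r" using g(2) md by (auto simp: Q_def intro!: exI[of _ ?g'])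
    then show False using \<open>r < m\<close> not_less_Least unfolding m_def by blast
  qed
  then show ?thesis using g by (auto simp: primitive_param_def)
qed

subsection \<open>Factorization\<close>

definition at_x0 :: "series2 \<Rightarrow> complex fps" where
  "at_x0 F = Abs_fps (\<lambda>j. F $ j $ 0)"

lemma at_x0_nth [simp]: "at_x0 F $ j = F $ j $ 0"
  by (simp add: at_x0_def)

lemma at_x0_mult: "at_x0 (F * G) = at_x0 F * at_x0 G"
  by (rule fps_ext) (simp add: fps_mult_nth fps_sum_nth)

lemma coord_x_dvd_iff: "coord_x dvd F \<longleftrightarrow> at_x0 F = 0"
proof
  assume "coord_x dvd F"
  then show "at_x0 F = 0" by (auto simp: coord_x_def fps_eq_iff elim!: dvdE)
next
  assume *: "at_x0 F = 0"
  have "F = coord_x * Abs_fps (\<lambda>j. fps_shift 1 (F $ j))"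
  proof (intro fps_ext)
    fix j i
    have "F $ j $ 0 = 0" using * by (metis at_x0_nth fps_zero_nth)
    then show "F $ j $ i = (coord_x * Abs_fps (\<lambda>j. fps_shift 1 (F $ j))) $ j $ i"
      by (cases i) (auto simp: coord_x_def)
  qed
  then show "coord_x dvd F" by (metis dvd_triv_left)
qed

lemma prime_elem_coord_x: "prime_elem coord_x"
proof (rule prime_elemI)
  show "coord_x \<noteq> 0" by (auto simp: coord_x_def)
  show "\<not> coord_x dvd 1" by (simp add: series2_is_unit_iff coord_x_def)
qed (simp add: coord_x_dvd_iff at_x0_mult)

text \<open>The order of F(0, y) serves as the d of \<open>newton_puiseux\<close>: it is finite as x
  does not divide F, and positive as F is not a unit.\<close>

lemma min_poly_factor_exists:
  assumes "\<not> F dvd 1" "\<not> coord_x dvd F"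
  shows "\<exists>n h. primitive_param n h \<and> min_poly n h dvd F"
proof -
  have nz: "at_x0 F \<noteq> 0" using assms coord_x_dvd_iff by blast
  let ?d = "subdegree (at_x0 F)"
  have "F $ ?d $ 0 \<noteq> 0" using nz by (metis at_x0_nth nth_subdegree_nonzero)
  moreover have "F $ j $ 0 = 0" if "j < ?d" for j using that by (metis at_x0_nth nth_less_subdegree_zero)
  moreover have "?d > 0" using nz assms(1) by (auto simp: series2_is_unit_iff subdegree_eq_0_iff intro!: gr0I)
  ultimately have "\<exists>n h. n > 0 \<and> h $ 0 = 0 \<and> ev h (base_change (fps_X ^ n) F) = 0"
    by (intro newton_puiseux)
  then show ?thesis using primitive_root_exists min_poly_dvd_iff by metis
qed

lemma irreducible_min_poly:
  assumes "irreducible F" "\<not> coord_x dvd F"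
  obtains n h U where "primitive_param n h" "U dvd 1" "F = U * min_poly n h"
proof -
  have "\<not> F dvd 1" using assms by (simp add: irreducible_def)
  then obtain n h where nh: "primitive_param n h" "min_poly n h dvd F"
    using min_poly_factor_exists assms by blast
  then obtain U where U: "F = U * min_poly n h" by (metis dvdE mult.commute)
  have "\<not> min_poly n h dvd 1" using prime_elem_min_poly[OF nh(1)] by (simp add: prime_elem_def)
  then have "U dvd 1" using irreducibleD[OF assms(1) U] by blast
  then show thesis using that nh U by blast
qed

text \<open>Each factor split off lowers the order of F(0, y). Squarefreeness keeps the new factor
  out of the set S, so that a product over a set, without multiplicities, is enough.\<close>

lemma squarefree_factorization:
  assumes "squarefree F" "\<not> coord_x dvd F"
  shows "\<exists>S U. finite S \<and> U dvd 1 \<and> F = U * \<Prod>S \<and> (\<forall>G\<in>S. \<exists>n h. primitive_param n h \<and> G = min_poly n h)"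
  using assms
proof (induction "subdegree (at_x0 F)" arbitrary: F rule: less_induct)
  case less
  show ?case
  proof (cases "F dvd 1")
    case True
    then show ?thesis by (intro exI[of _ "{}"] exI[of _ F]) simp
  next
    case False
    then obtain n h where nh: "primitive_param n h" "min_poly n h dvd F"
      using min_poly_factor_exists less.prems by blast
    define G where "G = min_poly n h"
    have G: "\<not> G dvd 1" using prime_elem_min_poly[OF nh(1)] by (simp add: prime_elem_def G_def)
    obtain Q where Q: "F = G * Q" using nh by (auto simp: G_def elim: dvdE)
    have nz: "at_x0 F \<noteq> 0" using less.prems coord_x_dvd_iff by blast
    then have nz': "at_x0 G \<noteq> 0" "at_x0 Q \<noteq> 0" by (auto simp: Q at_x0_mult)
    have "subdegree (at_x0 G) > 0"
      using G nz' by (auto simp: series2_is_unit_iff subdegree_eq_0_iff intro!: gr0I)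
    then have "subdegree (at_x0 Q) < subdegree (at_x0 F)"
      using nz' by (simp add: Q at_x0_mult)
    moreover have "squarefree Q"
      using less.prems(1) unfolding squarefree_def Q by (metis dvd_mult)
    moreover have "\<not> coord_x dvd Q" using nz' coord_x_dvd_iff by blast
    ultimately obtain S U where S: "finite S" "U dvd 1" "Q = U * \<Prod>S"
      "\<forall>G\<in>S. \<exists>n h. primitive_param n h \<and> G = min_poly n h"
      using less.hyps by blast
    have "G \<notin> S"
    proof
      assume "G \<in> S"
      then have "G dvd Q" using S by (auto intro: dvd_mult)
      then have "G\<^sup>2 dvd F" by (simp add: Q power2_eq_square mult_dvd_mono)
      then show False using G less.prems(1) by (auto dest: squarefreeD)
    qed
    then have "F = U * \<Prod>(insert G S)" using S by (simp add: Q mult_ac)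
    then show ?thesis using S nh unfolding G_def by (intro exI[of _ "insert (min_poly n h) S"] exI[of _ U]) auto
  qed
qed

subsection \<open>The support of a prime element\<close>

text \<open>Give x the weight 1 and y the weight e: all terms of each factor have weight at least e,
  so all terms of the product have weight at least e * n.\<close>

lemma linear_factors_prod_nth:
  fixes g :: "nat \<Rightarrow> complex fps"
  assumes "\<And>k. k < n \<Longrightarrow> fps_X ^ e dvd g k"
  defines "P \<equiv> \<lambda>n. \<Prod>k<n. fps_X - fps_const (g k)"
  shows "P n $ n = 1" and "\<And>j. j > n \<Longrightarrow> P n $ j = 0"
    and "\<And>j. j \<le> n \<Longrightarrow> fps_X ^ (e * (n - j)) dvd P n $ j" and "P n $ 0 = (\<Prod>k<n. - g k)"
proof -
  have P: "P (Suc m) $ j = (if j = 0 then 0 else P m $ (j - 1)) - P m $ j * g m" for m j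
  proof -
    have "P (Suc m) = P m * fps_X - P m * fps_const (g m)"
      by (simp add: P_def algebra_simps)
    then show ?thesis by simp
  qed
  have "P n $ n = 1 \<and> (\<forall>j>n. P n $ j = 0) \<and> (\<forall>j\<le>n. fps_X ^ (e * (n - j)) dvd P n $ j) \<and>
      P n $ 0 = (\<Prod>k<n. - g k)"
    using assms(1)
  proof (induction n)
    case 0
    then show ?case by (simp add: P_def)
  next
    case (Suc n)
    then have IH: "P n $ n = 1" "\<And>j. j > n \<Longrightarrow> P n $ j = 0"
      "\<And>j. j \<le> n \<Longrightarrow> fps_X ^ (e * (n - j)) dvd P n $ j" "P n $ 0 = (\<Prod>k<n. - g k)" by auto
    have "fps_X ^ (e * (Suc n - j)) dvd P (Suc n) $ j" if "j \<le> Suc n" for j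
    proof -
      have "fps_X ^ (e * (Suc n - j)) dvd P n $ j * g n"
      proof (cases "j \<le> n")
        case True
        then have "e * (Suc n - j) = e * (n - j) + e" by (simp add: Suc_diff_le)
        then show ?thesis using IH(3)[OF True] Suc.prems[of n] by (simp add: power_add mult_dvd_mono)
      qed (simp add: IH(2))
      moreover have "fps_X ^ (e * (Suc n - j)) dvd P n $ (j - 1)" if "j > 0"
        using IH(3)[of "j - 1"] that \<open>j \<le> Suc n\<close> by simp
      ultimately show ?thesis by (auto simp: P)
    qed
    then show ?case using IH by (auto simp: P simp flip: mult.commute[of "- g n"])
  qed
  then show "P n $ n = 1" and "\<And>j. j > n \<Longrightarrow> P n $ j = 0"
    and "\<And>j. j \<le> n \<Longrightarrow> fps_X ^ (e * (n - j)) dvd P n $ j" and "P n $ 0 = (\<Prod>k<n. - g k)" by auto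
qed

text \<open>The exponent i of x is the exponent n * i of t. All conjugates have the order e of h, so
  the constant term in y has order n * e in t, that is, e in x.\<close>

lemma min_poly_support:
  assumes "primitive_param n h" "h \<noteq> 0"
  defines "e \<equiv> subdegree h"
  shows "min_poly n h $ 0 $ e \<noteq> 0" "min_poly n h $ n $ 0 \<noteq> 0"
    "\<And>i j. min_poly n h $ j $ i \<noteq> 0 \<Longrightarrow> j \<le> n \<and> e * (n - j) \<le> n * i"
proof -
  have n: "n > 0" using assms by (auto simp: primitive_param_def)
  have mp: "min_poly n h $ j $ i = conjugate_product n h $ j $ (n * i)" for i j
    unfolding base_change_min_poly[OF n, symmetric] by (simp add: fps_compose_X_power_nth n)
  have nz: "conjugate n h k $ e \<noteq> 0" for k using assms(2) by (simp add: e_def)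
  have low: "conjugate n h k $ i = 0" if "i < e" for k i
    using nth_less_subdegree_zero[of i h] that unfolding e_def by simp
  have sub: "subdegree (conjugate n h k) = e" for k
    using nz low by (rule subdegreeI)
  have nonzero: "conjugate n h k \<noteq> 0" for k using nz[of k] by (metis fps_zero_nth)
  have "fps_X ^ e dvd conjugate n h k" for k
    unfolding X_power_dvd_iff using low by blast
  note prods = linear_factors_prod_nth[of n e "conjugate n h", OF this, folded conjugate_product_def]
  show "min_poly n h $ n $ 0 \<noteq> 0" by (simp add: mp prods)
  have "subdegree (\<Prod>k<m. - conjugate n h k) = e * m \<and> (\<Prod>k<m. - conjugate n h k) \<noteq> 0" for m
    by (induction m) (simp_all add: sub nonzero)
  then have "(\<Prod>k<n. - conjugate n h k) $ (n * e) \<noteq> 0"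
    by (metis mult.commute nth_subdegree_nonzero)
  then show "min_poly n h $ 0 $ e \<noteq> 0" by (simp add: mp prods)
  show "j \<le> n \<and> e * (n - j) \<le> n * i" if "min_poly n h $ j $ i \<noteq> 0" for i j
  proof -
    have *: "conjugate_product n h $ j $ (n * i) \<noteq> 0" using that by (simp add: mp)
    then have "j \<le> n" using prods(2)[of j] by (metis fps_zero_nth not_le)
    moreover have "e * (n - j) \<le> n * i"
      using prods(3)[OF \<open>j \<le> n\<close>] * unfolding X_power_dvd_iff by (metis not_le)
    ultimately show ?thesis by blast
  qed
qed

subsection \<open>Newton polygons\<close>

definition quadrant :: "(real \<times> real) set" where
  "quadrant = {q. 0 \<le> fst q \<and> 0 \<le> snd q}"

lemma quadrant_alt: "quadrant = {0..} \<times> {0..}"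
  by (auto simp: quadrant_def)

lemma quadrant_plus_quadrant: "quadrant + quadrant = quadrant"
proof
  show "quadrant + quadrant \<subseteq> quadrant" by (auto simp: quadrant_def elim!: set_plus_elim)
  show "quadrant \<subseteq> quadrant + quadrant" by (rule set_zero_plus2) (simp add: quadrant_def)
qed

lemma convex_quadrant: "convex quadrant"
  by (simp add: quadrant_alt convex_Times)

lemma newton_hull_eq: "newton_hull S = convex hull S + quadrant"
proof -
  have "{p + q | p q. p \<in> S \<and> 0 \<le> fst q \<and> 0 \<le> snd q} = S + quadrant"
    unfolding set_plus_def quadrant_def by blast
  then show ?thesis
    using convex_quadrant by (simp add: newton_hull_def convex_hull_set_plus hull_same)
qed

lemma newton_hull_plus: "newton_hull S + newton_hull T = newton_hull (S + T)"
proof -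
  have "newton_hull S + newton_hull T = (convex hull S + convex hull T) + (quadrant + quadrant)"
    unfolding newton_hull_eq by (simp only: ac_simps)
  then show ?thesis by (simp add: quadrant_plus_quadrant newton_hull_eq convex_hull_set_plus)
qed

lemma newton_hull_plus_quadrant: "newton_hull S + quadrant = newton_hull S"
  by (simp add: newton_hull_eq add.assoc quadrant_plus_quadrant)

lemma convex_newton_hull: "convex (newton_hull S)"
  by (simp add: newton_hull_eq convex_set_plus convex_quadrant)

lemma subset_newton_hull: "S \<subseteq> newton_hull S"
proof -
  have "convex hull S \<subseteq> convex hull S + quadrant"
    by (subst add.commute) (rule set_zero_plus2, simp add: quadrant_def)
  then show ?thesis unfolding newton_hull_eq by (rule order_trans[OF hull_subset])
qed

lemma newton_hull_subset:
  assumes "S \<subseteq> newton_hull T"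
  shows "newton_hull S \<subseteq> newton_hull T"
proof -
  have "convex hull S \<subseteq> newton_hull T" by (intro hull_minimal assms convex_newton_hull)
  then have "convex hull S + quadrant \<subseteq> newton_hull T + quadrant" by (rule set_plus_mono2) simp
  then show ?thesis by (simp only: newton_hull_plus_quadrant newton_hull_eq[of S])
qed

text \<open>The last inequality puts (i, j) on or to the right of the point of the segment at height
  j, whose parameter is t = j / n.\<close>

lemma newton_hull_segment:
  assumes "0 < n" "0 \<le> j" "j \<le> n" "e * (n - j) \<le> n * i"
  shows "(i, j) \<in> newton_hull {(e, 0), (0, n)}"
proof -
  define t where "t = j / n"
  have t: "0 \<le> t" "t \<le> 1" "t * n = j" using assms by (auto simp: t_def)
  have "(1 - t) *\<^sub>R (e, 0) + t *\<^sub>R (0, n) \<in> convex hull {(e, 0), (0, n)}"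
    by (rule convexD[OF convex_convex_hull]) (use t in \<open>auto intro: hull_inc\<close>)
  moreover have "(i - (1 - t) * e, 0) \<in> quadrant"
  proof -
    have "n * ((1 - t) * e) = e * (n - j)" using t(3) by (simp add: algebra_simps)
    then have "n * ((1 - t) * e) \<le> n * i" using assms(4) by (rule ord_eq_le_trans)
    then have "(1 - t) * e \<le> i" using assms(1) mult_le_cancel_left_pos by blast
    then show ?thesis by (simp add: quadrant_def)
  qed
  ultimately have "((1 - t) *\<^sub>R (e, 0) + t *\<^sub>R (0, n)) + (i - (1 - t) * e, 0) \<in> newton_hull {(e, 0), (0, n)}"
    unfolding newton_hull_eq by (rule set_plus_intro)
  then show ?thesis using t(3) by simp
qed

text \<open>Adding one more segment of the same direction only produces mixed vertices on the longer
  segment. The multiple is a successor because the empty Minkowski sum is the origin and not the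
  quadrant.\<close>

lemma minkowski_multiple_segment:
  "minkowski_multiple (Suc k) (newton_hull {(a, 0), (0, 1)}) =
     newton_hull {(real (Suc k) * a, 0), (0, real (Suc k))}"
proof (induction k)
  case 0
  then show ?case by (simp add: minkowski_multiple_def)
next
  case (Suc k)
  define r where "r = real (Suc k)"
  have "r > 0" by (simp add: r_def)
  have "minkowski_multiple (Suc (Suc k)) (newton_hull {(a, 0), (0, 1)}) =
      newton_hull {(r * a, 0), (0, r)} + newton_hull {(a, 0), (0, 1)}"
    using Suc by (simp add: minkowski_multiple_def r_def add.commute del: of_nat_Suc)
  also have "\<dots> = newton_hull {((r + 1) * a, 0), (a, r), (r * a, 1), (0, r + 1)}"
    unfolding newton_hull_plus by (rule arg_cong[of _ _ newton_hull]) (auto simp: set_plus_def algebra_simps)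
  also have "\<dots> = newton_hull {((r + 1) * a, 0), (0, r + 1)}"
  proof
    have "(a, r) \<in> newton_hull {((r + 1) * a, 0), (0, r + 1)}"
      "(r * a, 1) \<in> newton_hull {((r + 1) * a, 0), (0, r + 1)}"
      using \<open>r > 0\<close> by (auto intro!: newton_hull_segment simp: algebra_simps)
    then show "newton_hull {((r + 1) * a, 0), (a, r), (r * a, 1), (0, r + 1)} \<subseteq>
        newton_hull {((r + 1) * a, 0), (0, r + 1)}"
      using subset_newton_hull[of "{((r + 1) * a, 0), (0, r + 1)}"] by (intro newton_hull_subset) auto
    show "newton_hull {((r + 1) * a, 0), (0, r + 1)} \<subseteq>
        newton_hull {((r + 1) * a, 0), (a, r), (r * a, 1), (0, r + 1)}"
      using subset_newton_hull[of "{((r + 1) * a, 0), (a, r), (r * a, 1), (0, r + 1)}"]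
      by (intro newton_hull_subset) auto
  qed
  finally show ?case by (simp add: r_def add.commute)
qed

lemma in_supp_iff [simp]: "(real i, real j) \<in> supp F \<longleftrightarrow> F $ j $ i \<noteq> 0"
  by (auto simp: supp_def)

text \<open>Let i be the least exponent of x, attained in row J. The point (i, J) dominates all rows
  above J, and each of the finitely many other rows is dominated by its first point.\<close>

lemma supp_finite_basis:
  assumes "F \<noteq> 0"
  obtains T where "finite T" "T \<noteq> {}" "T \<subseteq> supp F" "supp F \<subseteq> T + quadrant"
proof -
  define i where "i = (LEAST i. \<exists>j. F $ j $ i \<noteq> 0)"
  have "\<exists>i j. F $ j $ i \<noteq> 0" using assms by (metis fps_ext fps_zero_nth)
  then have "\<exists>j. F $ j $ i \<noteq> 0" unfolding i_def by (rule LeastI_ex)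
  then obtain J where J: "F $ J $ i \<noteq> 0" by blast
  define T where "T = (\<lambda>j. (real (subdegree (F $ j)), real j)) ` {j. j \<le> J \<and> F $ j \<noteq> 0} \<union> {(real i, real J)}"
  have "supp F \<subseteq> T + quadrant"
  proof
    fix z assume "z \<in> supp F"
    then obtain k l where z: "z = (real k, real l)" "F $ l $ k \<noteq> 0" by (auto simp: supp_def)
    have "\<exists>t\<in>T. fst t \<le> fst z \<and> snd t \<le> snd z"
    proof (cases "l \<le> J")
      case True
      have "F $ l \<noteq> 0" using z(2) by (metis fps_zero_nth)
      then have "(real (subdegree (F $ l)), real l) \<in> T" using True by (auto simp: T_def)
      then show ?thesis using subdegree_leI[OF z(2)] z(1) by (intro bexI) auto
    next
      case False
      have "i \<le> k" unfolding i_def using z(2) by (intro Least_le) blast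
      then show ?thesis using False z(1) by (intro bexI[of _ "(real i, real J)"]) (auto simp: T_def)
    qed
    then obtain t where t: "t \<in> T" "fst t \<le> fst z" "snd t \<le> snd z" by blast
    then have "t + (z - t) \<in> T + quadrant" by (intro set_plus_intro) (auto simp: quadrant_def)
    then show "z \<in> T + quadrant" by simp
  qed
  moreover have "finite T" "T \<noteq> {}" "T \<subseteq> supp F" using J by (auto simp: T_def)
  ultimately show thesis using that by blast
qed

text \<open>A compact polygon plus a closed quadrant is closed; closedness allows strict separation
  of an outside point.\<close>

lemma closed_newton_hull_supp:
  assumes "F \<noteq> 0"
  shows "closed (newton_hull (supp F))"
proof -
  obtain T where T: "finite T" "T \<noteq> {}" "T \<subseteq> supp F" "supp F \<subseteq> T + quadrant"
    using supp_finite_basis[OF assms] .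
  have "T + quadrant \<subseteq> newton_hull T"
    unfolding newton_hull_eq by (intro set_plus_mono2 hull_subset) simp
  then have "newton_hull (supp F) = newton_hull T"
    using T(3,4) subset_newton_hull[of "supp F"] by (intro equalityI newton_hull_subset) auto
  moreover have "closed (\<Union>x\<in>convex hull T. \<Union>y\<in>quadrant. {x + y})"
    by (rule compact_closed_sums[OF finite_imp_compact_convex_hull[OF T(1)]])
      (simp add: quadrant_alt closed_Times)
  moreover have "(\<Union>x\<in>convex hull T. \<Union>y\<in>quadrant. {x + y}) = newton_hull T"
    unfolding newton_hull_eq by (auto simp: set_plus_def)
  ultimately show ?thesis by metis
qed

section \<open>The Newton polygon of a product\<close>

lemma series2_mult_nth:
  "(F * G :: series2) $ J $ I = (\<Sum>j\<le>J. \<Sum>i\<le>I. F $ j $ i * G $ (J - j) $ (I - i))"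
  by (simp add: fps_mult_nth fps_sum_nth atLeast0AtMost)

lemma supp_mult: "supp (F * G) \<subseteq> supp F + supp G"
proof
  fix z assume "z \<in> supp (F * G)"
  then obtain I J where z: "z = (real I, real J)" "(F * G) $ J $ I \<noteq> 0" by (auto simp: supp_def)
  then obtain j where "j \<le> J" "(\<Sum>i\<le>I. F $ j $ i * G $ (J - j) $ (I - i)) \<noteq> 0"
    unfolding series2_mult_nth by (meson atMost_iff sum.not_neutral_contains_not_neutral)
  then obtain i where ij: "j \<le> J" "i \<le> I" "F $ j $ i * G $ (J - j) $ (I - i) \<noteq> 0"
    by (meson atMost_iff sum.not_neutral_contains_not_neutral)
  then have "(real i, real j) \<in> supp F" "(real (I - i), real (J - j)) \<in> supp G"
    unfolding in_supp_iff by auto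
  then have "(real i, real j) + (real (I - i), real (J - j)) \<in> supp F + supp G"
    by (rule set_plus_intro)
  then show "z \<in> supp F + supp G" using z ij by (simp add: of_nat_diff)
qed

text \<open>
  For positive weights, the exponent that is minimal for the weight and then for its first entry
  is additive, since it is the minimum for a total order of the monoid of exponents.
\<close>

lemma weight_minimizer:
  fixes F :: series2
  assumes "F \<noteq> 0" "u > 0" "v > 0"
  shows "\<exists>a b. F $ b $ a \<noteq> 0 \<and>
    (\<forall>i j. F $ j $ i \<noteq> 0 \<longrightarrow> u * real a + v * real b \<le> u * real i + v * real j) \<and>
    (\<forall>i j. F $ j $ i \<noteq> 0 \<longrightarrow> u * real i + v * real j = u * real a + v * real b \<longrightarrow> a \<le> i)"
proof -
  define w where "w = (\<lambda>p :: real \<times> real. u * fst p + v * snd p)"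
  obtain T where T: "finite T" "T \<noteq> {}" "T \<subseteq> supp F" "supp F \<subseteq> T + quadrant"
    using supp_finite_basis[OF assms(1)] .
  obtain t where t: "t \<in> T" "\<And>s. s \<in> T \<Longrightarrow> w t \<le> w s"
    using arg_min_if_finite[OF T(1,2), of w] by (metis linorder_not_less)
  have min: "w t \<le> w p" if "p \<in> supp F" for p
  proof -
    have "p \<in> T + quadrant" using that T(4) by blast
    then obtain s q where "p = s + q" "s \<in> T" "q \<in> quadrant" by (rule set_plus_elim)
    moreover have "w (s + q) = w s + (u * fst q + v * snd q)" by (simp add: w_def algebra_simps)
    moreover have "0 \<le> u * fst q + v * snd q"
      using \<open>q \<in> quadrant\<close> assms(2,3) by (simp add: quadrant_def)
    ultimately show ?thesis using t(2)[of s] by simp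
  qed
  define P where "P = (\<lambda>a. \<exists>b. F $ b $ a \<noteq> 0 \<and> w (real a, real b) = w t)"
  define a where "a = (LEAST a. P a)"
  have "t \<in> supp F" using t T by blast
  then have "\<exists>a. P a" by (auto simp: supp_def P_def)
  then have "P a" unfolding a_def by (rule LeastI_ex)
  then obtain b where b: "F $ b $ a \<noteq> 0" "w (real a, real b) = w t" by (auto simp: P_def)
  show ?thesis
  proof (intro exI conjI allI impI)
    show "F $ b $ a \<noteq> 0" by (rule b(1))
    show "u * real a + v * real b \<le> u * real i + v * real j" if "F $ j $ i \<noteq> 0" for i j
      using min[of "(real i, real j)"] that b(2) by (simp add: w_def)
    show "a \<le> i" if "F $ j $ i \<noteq> 0" "u * real i + v * real j = u * real a + v * real b" for i j
      unfolding a_def using that b(2) by (intro Least_le) (auto simp: P_def w_def)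
  qed
qed

text \<open>At the sum of the two minimizing exponents, the coefficient of F * G is a single product
  of nonzero coefficients: breaking ties by the first entry excludes cancellation.\<close>

lemma weight_min_mult:
  fixes F G :: series2
  assumes "F \<noteq> 0" "G \<noteq> 0" "u > 0" "v > 0"
  shows "\<exists>I J. (F * G) $ J $ I \<noteq> 0 \<and>
    (\<forall>i j k l. F $ j $ i \<noteq> 0 \<longrightarrow> G $ l $ k \<noteq> 0 \<longrightarrow>
      u * real I + v * real J \<le> u * (real i + real k) + v * (real j + real l))"
proof -
  obtain a b where ab: "F $ b $ a \<noteq> 0"
    "\<And>i j. F $ j $ i \<noteq> 0 \<Longrightarrow> u * real a + v * real b \<le> u * real i + v * real j"
    "\<And>i j. F $ j $ i \<noteq> 0 \<Longrightarrow> u * real i + v * real j = u * real a + v * real b \<Longrightarrow> a \<le> i"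
    using weight_minimizer[OF assms(1,3,4)] by blast
  obtain c d where cd: "G $ d $ c \<noteq> 0"
    "\<And>i j. G $ j $ i \<noteq> 0 \<Longrightarrow> u * real c + v * real d \<le> u * real i + v * real j"
    "\<And>i j. G $ j $ i \<noteq> 0 \<Longrightarrow> u * real i + v * real j = u * real c + v * real d \<Longrightarrow> c \<le> i"
    using weight_minimizer[OF assms(2,3,4)] by blast
  have uniq: "i = a \<and> j = b"
    if ij: "i \<le> a + c" "j \<le> b + d" and nz: "F $ j $ i \<noteq> 0" "G $ (b + d - j) $ (a + c - i) \<noteq> 0" for i j
  proof -
    have *: "u * real a + v * real b \<le> u * real i + v * real j"
      "u * real c + v * real d \<le> u * (real a + real c - real i) + v * (real b + real d - real j)"
      using ab(2)[OF nz(1)] cd(2)[OF nz(2)] ij by (simp_all add: of_nat_diff)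
    then have eq: "u * real i + v * real j = u * real a + v * real b"
      "u * (real a + real c - real i) + v * (real b + real d - real j) = u * real c + v * real d"
      by (simp_all add: algebra_simps)
    have "a \<le> i" using ab(3)[OF nz(1) eq(1)] .
    moreover have "c \<le> a + c - i" using cd(3)[OF nz(2)] eq(2) ij by (simp add: of_nat_diff)
    ultimately have "i = a" using ij by linarith
    then show ?thesis using eq(1) assms(4) by simp
  qed
  have "(F * G) $ (b + d) $ (a + c) =
      (\<Sum>j\<le>b + d. \<Sum>i\<le>a + c. if j = b \<and> i = a then F $ b $ a * G $ d $ c else 0)"
    unfolding series2_mult_nth by (intro sum.cong refl) (use uniq in auto)
  also have "\<dots> = (\<Sum>j\<le>b + d. if j = b then F $ b $ a * G $ d $ c else 0)"
    by (intro sum.cong refl) auto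
  also have "\<dots> = F $ b $ a * G $ d $ c" by simp
  finally have "(F * G) $ (b + d) $ (a + c) \<noteq> 0" using ab(1) cd(1) by simp
  moreover have "u * real (a + c) + v * real (b + d) \<le> u * (real i + real k) + v * (real j + real l)"
    if "F $ j $ i \<noteq> 0" "G $ l $ k \<noteq> 0" for i j k l
    using ab(2)[OF that(1)] cd(2)[OF that(2)] by (simp add: algebra_simps)
  ultimately show ?thesis by blast
qed

text \<open>A point of the sum outside the closed hull \<open>?K\<close> would be strictly separated
  from it. The separating weights are nonnegative as \<open>?K\<close> absorbs the quadrant; made
  positive, their minimum over the support of F * G is at most the value at the point, a
  contradiction.\<close>

theorem newton_hull_supp_mult:
  assumes "F \<noteq> 0" "G \<noteq> 0"
  shows "newton_hull (supp (F * G)) = newton_hull (supp F) + newton_hull (supp G)"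
  unfolding newton_hull_plus
proof
  let ?K = "newton_hull (supp (F * G))"
  show "?K \<subseteq> newton_hull (supp F + supp G)"
    using supp_mult subset_newton_hull by (intro newton_hull_subset) blast
  show "newton_hull (supp F + supp G) \<subseteq> ?K"
  proof (intro newton_hull_subset subsetI)
    fix z assume "z \<in> supp F + supp G"
    then obtain i j k l where z: "z = (real i + real k, real j + real l)"
      "F $ j $ i \<noteq> 0" "G $ l $ k \<noteq> 0"
      by (auto simp: supp_def elim!: set_plus_elim)
    show "z \<in> ?K"
    proof (rule ccontr)
      assume "z \<notin> ?K"
      then obtain a b where ab: "inner a z < b" "\<And>x. x \<in> ?K \<Longrightarrow> inner a x > b"
        using separating_hyperplane_closed_point[OF convex_newton_hull closed_newton_hull_supp, of "F * G" z] assms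
        by auto
      obtain k0 where k0: "k0 \<in> ?K"
        using supp_finite_basis[of "F * G"] subset_newton_hull[of "supp (F * G)"] assms
        by (metis ex_in_conv mult_eq_0_iff subset_eq)
      have nonneg: "inner a e \<ge> 0" if "e \<in> quadrant" for e
      proof (rule ccontr)
        assume neg: "\<not> inner a e \<ge> 0"
        \<comment> \<open>Moving from k0 by t in the direction e brings the functional down to
          exactly b, although it exceeds b on all of \<open>?K\<close>.\<close>
        define t where "t = (inner a k0 - b) / - inner a e"
        have "t \<ge> 0" using ab(2)[OF k0] neg by (simp add: t_def divide_nonneg_neg)
        then have "t *\<^sub>R e \<in> quadrant" using that by (auto simp: quadrant_def)
        then have "k0 + t *\<^sub>R e \<in> ?K" using k0 newton_hull_plus_quadrant by blast
        then have "inner a k0 + t * inner a e > b" using ab(2) by (fastforce simp: inner_add_right)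
        then show False using neg by (simp add: t_def)
      qed
      have a: "fst a \<ge> 0" "snd a \<ge> 0"
        using nonneg[of "(1, 0)"] nonneg[of "(0, 1)"] by (simp_all add: quadrant_def inner_prod_def)
      \<comment> \<open>One more than the sum of the coordinates of z: raising both weights by
        \<epsilon> raises the value at z by \<epsilon> * (s - 1), so it becomes b - \<epsilon> and
        stays below b.\<close>
      define s where "s = real i + real k + real j + real l + 1"
      define \<epsilon> where "\<epsilon> = (b - inner a z) / s"
      have "s > 0" by (simp add: s_def)
      then have \<epsilon>: "\<epsilon> > 0" "\<epsilon> * s = b - inner a z" using ab(1) by (simp_all add: \<epsilon>_def)
      define u v where "u = fst a + \<epsilon>" and "v = snd a + \<epsilon>"
      have uv: "u > 0" "v > 0" using a \<epsilon> by (auto simp: u_def v_def)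
      obtain I J where IJ: "(F * G) $ J $ I \<noteq> 0"
        "\<And>i j k l. F $ j $ i \<noteq> 0 \<Longrightarrow> G $ l $ k \<noteq> 0 \<Longrightarrow>
          u * real I + v * real J \<le> u * (real i + real k) + v * (real j + real l)"
        using weight_min_mult[OF assms uv] by blast
      have "(real I, real J) \<in> ?K" using IJ(1) subset_newton_hull in_supp_iff by blast
      then have "fst a * real I + snd a * real J > b"
        using ab(2)[of "(real I, real J)"] by (simp add: inner_prod_def)
      moreover have "\<epsilon> * real I \<ge> 0" "\<epsilon> * real J \<ge> 0" using \<epsilon>(1) by simp_all
      ultimately have "u * real I + v * real J > b"
        by (simp add: u_def v_def distrib_right)
      moreover have "u * (real i + real k) + v * (real j + real l) = inner a z + \<epsilon> * s - \<epsilon>"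
        by (simp add: z(1) inner_prod_def u_def v_def s_def algebra_simps)
      ultimately show False using IJ(2)[OF z(2,3)] \<epsilon> by simp
    qed
  qed
qed

lemma newton_hull_supp_unit_mult:
  assumes "U dvd 1" "F \<noteq> 0"
  shows "newton_hull (supp (U * F)) = newton_hull (supp F)"
proof -
  have U: "U $ 0 $ 0 \<noteq> 0" using assms(1) series2_is_unit_iff by blast
  then have "U \<noteq> 0" by auto
  have "newton_hull (supp U) = newton_hull {(0, 0)}"
  proof (intro equalityI newton_hull_subset)
    show "supp U \<subseteq> newton_hull {(0, 0)}"
      by (auto simp: supp_def newton_hull_eq set_plus_def quadrant_def zero_prod_def)
    have "(0, 0) \<in> supp U" using U by (simp add: supp_def)
    then show "{(0, 0)} \<subseteq> newton_hull (supp U)" using subset_newton_hull[of "supp U"] by blast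
  qed
  moreover have "newton_hull {(0, 0)} = quadrant"
    by (auto simp: newton_hull_eq set_plus_def simp flip: zero_prod_def)
  ultimately show ?thesis
    using newton_hull_supp_mult[OF \<open>U \<noteq> 0\<close> assms(2)] newton_hull_plus_quadrant[of "supp F"]
    by (simp add: add.commute)
qed

text \<open>S is nonempty because the empty product has the quadrant as its polygon, while the empty
  Minkowski sum is the origin.\<close>

lemma newton_hull_supp_prod:
  assumes "finite S" "S \<noteq> {}" "\<And>G. G \<in> S \<Longrightarrow> G \<noteq> 0"
  shows "newton_hull (supp (\<Prod>S)) = (\<Sum>G\<in>S. newton_hull (supp G))"
  using assms
proof (induction S rule: finite_ne_induct)
  case (insert G S)
  then show ?case by (simp add: newton_hull_supp_mult)
qed simp

lemma newton_hull_min_poly: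
  assumes "primitive_param n h" "h \<noteq> 0"
  shows "newton_hull (supp (min_poly n h)) =
    minkowski_multiple n (newton_hull {(real (subdegree h) / real n, 0), (0, 1)})"
proof -
  have n: "n > 0" using assms by (simp add: primitive_param_def)
  note supp = min_poly_support[OF assms]
  have "newton_hull (supp (min_poly n h)) = newton_hull {(real (subdegree h), 0), (0, real n)}"
  proof (intro equalityI newton_hull_subset)
    show "supp (min_poly n h) \<subseteq> newton_hull {(real (subdegree h), 0), (0, real n)}"
    proof
      fix z assume "z \<in> supp (min_poly n h)"
      then obtain i j where z: "z = (real i, real j)" "min_poly n h $ j $ i \<noteq> 0"
        by (auto simp: supp_def)
      then have *: "j \<le> n" "subdegree h * (n - j) \<le> n * i" using supp(3) by auto
      then have "real (subdegree h) * (real n - real j) \<le> real n * real i"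
        by (metis of_nat_diff of_nat_le_iff of_nat_mult)
      then show "z \<in> newton_hull {(real (subdegree h), 0), (0, real n)}"
        unfolding z(1) using n *(1) by (intro newton_hull_segment) auto
    qed
    have "(real (subdegree h), real 0) \<in> supp (min_poly n h)" "(real 0, real n) \<in> supp (min_poly n h)"
      unfolding in_supp_iff using supp by auto
    then show "{(real (subdegree h), 0), (0, real n)} \<subseteq> newton_hull (supp (min_poly n h))"
      using subset_newton_hull[of "supp (min_poly n h)"] by auto
  qed
  moreover obtain k where "n = Suc k" using n gr0_conv_Suc by blast
  moreover have "real n * (real (subdegree h) / real n) = real (subdegree h)" using n by simp
  ultimately show ?thesis using minkowski_multiple_segment[of k] by metis
qed

text \<open>For h = 0 the premise of primitivity holds vacuously for k = 1, so n divides 1. This is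
  the branch L'.\<close>

lemma min_poly_0:
  assumes "primitive_param n 0"
  shows "n = 1" "min_poly n 0 = coord_y"
proof -
  have "n dvd 1" using assms unfolding primitive_param_def by (metis fps_zero_nth)
  then show n: "n = 1" by simp
  have "base_change (fps_X ^ 1) (min_poly 1 0) = fps_X"
    using base_change_min_poly[of 1 0] by (simp add: conjugate_product_def)
  moreover have "base_change (fps_X ^ 1) F = F" for F by (rule fps_ext) simp
  ultimately show "min_poly n 0 = coord_y" by (simp add: n coord_y_def)
qed

lemma supp_coord_y: "supp coord_y = {(0, 1)}"
  by (auto simp: supp_def coord_y_def fps_X_def split: if_splits)

subsection \<open>Puiseux series\<close>

lemma puiseux_nth [simp]: "n > 0 \<Longrightarrow> puiseux n h (of_nat i / of_nat n) = h $ i"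
  by (simp add: puiseux_def)

lemma puiseux_nonzeroE:
  assumes "puiseux n h q \<noteq> 0" "n > 0"
  obtains i where "q = of_nat i / of_nat n"
proof -
  have "q * of_nat n \<in> \<nat>" using assms(1) by (auto simp: puiseux_def split: if_splits)
  then obtain i where "q * of_nat n = of_nat i" by (rule Nats_cases)
  then show thesis using assms(2) by (intro that[of i]) (simp add: field_simps)
qed

lemma puiseux_inject: "n > 0 \<Longrightarrow> puiseux n h = puiseux n g \<longleftrightarrow> h = g"
  by (metis fps_ext puiseux_nth)

lemma puiseux_diff: "puiseux n h - puiseux n g = puiseux n (h - g)"
  by (auto simp: puiseux_def fun_eq_iff)

text \<open>x^(1/m) is the n-th power of x^(1/(m n)); this brings series with different denominators
  to a common one.\<close>

lemma puiseux_refine: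
  assumes "m > 0" "n > 0"
  shows "puiseux (m * n) (g oo fps_X ^ n) = puiseux m g"
proof
  fix q
  have mn: "m * n > 0" using assms by simp
  have up: "of_nat j / of_nat m = (of_nat (j * n) / of_nat (m * n) :: rat)" for j
    using assms by simp
  show "puiseux (m * n) (g oo fps_X ^ n) q = puiseux m g q"
  proof (cases "\<exists>i. q = of_nat i / of_nat (m * n)")
    case True
    then obtain i where q: "q = of_nat i / of_nat (m * n)" by blast
    have lhs: "puiseux (m * n) (g oo fps_X ^ n) q = (if n dvd i then g $ (i div n) else 0)"
      unfolding q puiseux_nth[OF mn] by (rule fps_compose_X_power_nth[OF assms(2)])
    show ?thesis
    proof (cases "n dvd i")
      case True
      then obtain j where j: "i = j * n" by (metis dvdE mult.commute)
      have "q = of_nat j / of_nat m" unfolding q j up ..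
      then show ?thesis using lhs j assms by simp
    next
      case False
      have "puiseux m g q = 0"
      proof (rule ccontr)
        assume "puiseux m g q \<noteq> 0"
        then obtain j where "q = of_nat j / of_nat m" using puiseux_nonzeroE assms(1) by blast
        then have "(of_nat i :: rat) = of_nat (j * n)"
          using q mn unfolding up by (metis divide_cancel_right of_nat_0_less_iff order_less_irrefl)
        then have "i = j * n" using of_nat_eq_iff by blast
        then show False using False by simp
      qed
      then show ?thesis using lhs False by simp
    qed
  next
    case False
    have "puiseux (m * n) (g oo fps_X ^ n) q = 0" using puiseux_nonzeroE[OF _ mn] False by metis
    moreover have "puiseux m g q = 0" using puiseux_nonzeroE[OF _ assms(1)] False up by metis
    ultimately show ?thesis by simp
  qed
qed

lemma puiseux_eq_iff:
  assumes "m > 0" "n > 0"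
  shows "puiseux n h = puiseux m g \<longleftrightarrow> h oo fps_X ^ m = g oo fps_X ^ n"
  using puiseux_inject[of "n * m" "h oo fps_X ^ m" "g oo fps_X ^ n"] puiseux_refine[of n m h]
    puiseux_refine[of m n g] assms by (simp add: mult.commute)

lemma puiseux_diff_common:
  assumes "m > 0" "n > 0"
  shows "puiseux n h - puiseux m g = puiseux (n * m) ((h oo fps_X ^ m) - (g oo fps_X ^ n))"
  using puiseux_refine[of n m h] puiseux_refine[of m n g] assms
  by (simp add: mult.commute flip: puiseux_diff)

lemma puiseux_order_eq:
  assumes "n > 0" "g \<noteq> 0"
  shows "puiseux_order (puiseux n g) = of_nat (subdegree g) / of_nat n"
  unfolding puiseux_order_def
proof (rule Least_equality)
  show "puiseux n g (of_nat (subdegree g) / of_nat n) \<noteq> 0" using assms by simp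
  fix q assume q: "puiseux n g q \<noteq> 0"
  then obtain i where i: "q = of_nat i / of_nat n" using puiseux_nonzeroE assms(1) by blast
  then have "g $ i \<noteq> 0" using q assms(1) by simp
  then show "of_nat (subdegree g) / of_nat n \<le> q"
    unfolding i by (intro divide_right_mono) (auto simp: subdegree_leI)
qed

lemma newton_puiseux_roots_eq:
  "newton_puiseux_roots F =
    {puiseux n h | n h. 0 < n \<and> h $ 0 = 0 \<and> ev h (base_change (fps_X ^ n) F) = 0}"
proof -
  have "(\<lambda>j. fps_compose (F $ j) (fps_X ^ n) * h ^ j) sums 0 \<longleftrightarrow> ev h (base_change (fps_X ^ n) F) = 0"
    if "h $ 0 = 0" for n h
    using ev_sums_iff[OF that, of "base_change (fps_X ^ n) F" 0] by simp
  then show ?thesis unfolding newton_puiseux_roots_def by blast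
qed

text \<open>A root may be presented with another denominator m; both presentations are pulled back
  to the common parameter x^(1/(n m)).\<close>

lemma min_poly_dvd_if_root:
  assumes "primitive_param n h" "puiseux n (conjugate n h k) \<in> newton_puiseux_roots F"
  shows "min_poly n h dvd F"
proof -
  have n: "n > 0" and h0: "h $ 0 = 0" using assms by (auto simp: primitive_param_def)
  let ?h = "conjugate n h k"
  obtain m g where mg: "puiseux n ?h = puiseux m g" "m > 0" "g $ 0 = 0"
    "ev g (base_change (fps_X ^ m) F) = 0"
    using assms(2) by (auto simp: newton_puiseux_roots_eq)
  have eq: "?h oo fps_X ^ m = g oo fps_X ^ n" using puiseux_eq_iff mg n by blast
  have "fps_X ^ n oo fps_X ^ m = (fps_X ^ m oo fps_X ^ n :: complex fps)"
    using n mg(2) by (simp add: X_power_compose mult.commute flip: power_mult)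
  then have "base_change (fps_X ^ m) (base_change (fps_X ^ n) F)
      = base_change (fps_X ^ n) (base_change (fps_X ^ m) F)"
    using n mg(2) by (simp add: base_change_base_change)
  then have "ev ?h (base_change (fps_X ^ n) F) oo fps_X ^ m = ev g (base_change (fps_X ^ m) F) oo fps_X ^ n"
    using ev_base_change[of ?h "fps_X ^ m" "base_change (fps_X ^ n) F"]
      ev_base_change[of g "fps_X ^ n" "base_change (fps_X ^ m) F"] eq n mg(2,3) h0 by simp
  then have "ev ?h (base_change (fps_X ^ n) F) = 0" using mg by (simp add: fps_compose_eq_0_iff)
  then have "ev h (base_change (fps_X ^ n) F) = 0"
    using ev_conjugate[OF n h0] by (simp add: fps_compose_eq_0_iff fps_mult_fps_X_commute[symmetric])
  then show ?thesis using min_poly_dvd_iff assms(1) by blast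
qed

text \<open>Over a common parameter the polynomial splits into the conjugate linear factors, and one
  of them must vanish at the given root, since the unit does not.\<close>

lemma newton_puiseux_roots_min_poly:
  assumes "primitive_param n h" "U dvd 1"
  shows "newton_puiseux_roots (U * min_poly n h) = (\<lambda>k. puiseux n (conjugate n h k)) ` {..<n}"
proof
  have n: "n > 0" and h0: "h $ 0 = 0" using assms by (auto simp: primitive_param_def)
  show "(\<lambda>k. puiseux n (conjugate n h k)) ` {..<n} \<subseteq> newton_puiseux_roots (U * min_poly n h)"
  proof safe
    fix k assume "k < n"
    have "ev (conjugate n h k) (base_change (fps_X ^ n) (U * min_poly n h)) = 0"
      using min_poly_dvd_iff[OF assms(1), of "U * min_poly n h"] by (simp add: ev_conjugate n h0)
    then show "puiseux n (conjugate n h k) \<in> newton_puiseux_roots (U * min_poly n h)"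
      unfolding newton_puiseux_roots_eq mem_Collect_eq
      by (intro exI[of _ n] exI[of _ "conjugate n h k"]) (simp add: n h0)
  qed
  show "newton_puiseux_roots (U * min_poly n h) \<subseteq> (\<lambda>k. puiseux n (conjugate n h k)) ` {..<n}"
  proof
    fix \<eta> assume "\<eta> \<in> newton_puiseux_roots (U * min_poly n h)"
    then obtain m g where mg: "\<eta> = puiseux m g" "m > 0" "g $ 0 = 0"
      "ev g (base_change (fps_X ^ m) (U * min_poly n h)) = 0"
      by (auto simp: newton_puiseux_roots_eq)
    have "ev g (base_change (fps_X ^ m) U) $ 0 \<noteq> 0" using assms(2) by (simp add: series2_is_unit_iff)
    then have "ev g (base_change (fps_X ^ m) U) \<noteq> 0" by (metis fps_zero_nth)
    then have "ev g (base_change (fps_X ^ m) (min_poly n h)) oo fps_X ^ n = 0"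
      using mg by (simp add: base_change_mult ev_mult)
    moreover have "fps_X ^ m oo fps_X ^ n = (fps_X ^ n oo fps_X ^ m :: complex fps)"
      using n mg(2) by (simp add: X_power_compose mult.commute flip: power_mult)
    then have "base_change (fps_X ^ n) (base_change (fps_X ^ m) (min_poly n h))
        = base_change (fps_X ^ m) (conjugate_product n h)"
      using n mg(2) by (simp add: base_change_base_change flip: base_change_min_poly)
    ultimately have "ev (g oo fps_X ^ n) (base_change (fps_X ^ m) (conjugate_product n h)) = 0"
      using ev_base_change[of g "fps_X ^ n" "base_change (fps_X ^ m) (min_poly n h)"] n mg(3) by simp
    then have "(\<Prod>k<n. (g oo fps_X ^ n) - (conjugate n h k oo fps_X ^ m)) = 0"
      using mg by (simp add: conjugate_product_def base_change_prod ev_prod base_change_diff)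
    then obtain k where "k < n" "g oo fps_X ^ n = conjugate n h k oo fps_X ^ m" by auto
    then have "puiseux m g = puiseux n (conjugate n h k)" using puiseux_eq_iff n mg(2) by blast
    then show "\<eta> \<in> (\<lambda>k. puiseux n (conjugate n h k)) ` {..<n}" using mg(1) \<open>k < n\<close> by blast
  qed
qed

text \<open>b is the reduced denominator of i/n; if it divides M, then M * i / n is an
  integer.\<close>

lemma quotient_of_denominator:
  fixes i n M :: nat
  assumes "n > 0"
  defines "b \<equiv> nat (snd (quotient_of (of_nat i / of_nat n)))"
  shows "b dvd n" "b dvd M \<Longrightarrow> n dvd M * i"
proof -
  obtain p q where pq: "quotient_of (of_nat i / of_nat n) = (p, q)" by fastforce
  have "q > 0" "coprime p q" using pq quotient_of_denom_pos quotient_of_coprime by blast+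
  have "of_nat i / of_nat n = (of_int p / of_int q :: rat)" using pq by (rule quotient_of_div)
  then have "of_int (int i * q) = (of_int (p * int n) :: rat)"
    using assms(1) \<open>q > 0\<close> by (simp add: field_simps)
  then have eq: "int i * q = p * int n" using of_int_eq_iff by blast
  have b: "int b = q" using \<open>q > 0\<close> by (simp add: b_def pq)
  have "q dvd p * int n" using eq by (metis dvd_triv_right)
  then have "q dvd int n" using \<open>coprime p q\<close> by (simp add: coprime_commute coprime_dvd_mult_right_iff)
  then show "b dvd n" using b by (metis int_dvd_int_iff)
  show "n dvd M * i" if "b dvd M"
  proof -
    obtain c where "M = b * c" using \<open>b dvd M\<close> by (rule dvdE)
    then have "int (M * i) = int i * q * int c" by (simp add: b)
    then have "int (M * i) = int n * (p * int c)" unfolding eq by simp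
    then show ?thesis by (metis dvd_triv_left int_dvd_int_iff)
  qed
qed

text \<open>
  \<open>\<eta>\<close> has order at least s; unlike the order itself this also makes sense for the zero series.
\<close>

definition order_ge :: "ennreal \<Rightarrow> (rat \<Rightarrow> complex) \<Rightarrow> bool" where
  "order_ge s \<eta> \<longleftrightarrow> (\<forall>r. ennreal_of_rat r < s \<longrightarrow> \<eta> r = 0)"

lemma order_ge_0 [simp]: "order_ge s (\<lambda>_. 0)"
  by (simp add: order_ge_def)

lemma order_ge_diff_iff: "order_ge s \<xi> \<Longrightarrow> order_ge s (\<xi> - \<xi>') \<longleftrightarrow> order_ge s \<xi>'"
  by (auto simp: order_ge_def)

lemma ennreal_of_rat_mono: "q \<le> r \<Longrightarrow> ennreal_of_rat q \<le> ennreal_of_rat r"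
  by (simp add: ennreal_of_rat_def ennreal_leI of_rat_less_eq)

lemma order_ge_iff:
  assumes "n > 0" "g \<noteq> 0"
  shows "order_ge s (puiseux n g) \<longleftrightarrow> s \<le> ennreal_of_rat (puiseux_order (puiseux n g))"
proof
  let ?q = "puiseux_order (puiseux n g)"
  have q: "?q = of_nat (subdegree g) / of_nat n" by (rule puiseux_order_eq[OF assms])
  show "s \<le> ennreal_of_rat ?q" if "order_ge s (puiseux n g)"
  proof -
    have "puiseux n g ?q \<noteq> 0" using assms by (simp add: q)
    then show ?thesis using that unfolding order_ge_def by (metis linorder_not_less)
  qed
  show "order_ge s (puiseux n g)" if s: "s \<le> ennreal_of_rat ?q"
    unfolding order_ge_def
  proof (intro allI impI)
    fix r assume "ennreal_of_rat r < s"
    then have "r < ?q" using s ennreal_of_rat_mono by (metis linorder_not_less order_less_le_trans)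
    show "puiseux n g r = 0"
    proof (rule ccontr)
      assume nz: "puiseux n g r \<noteq> 0"
      then obtain i where i: "r = of_nat i / of_nat n" using puiseux_nonzeroE assms(1) by blast
      then have "i < subdegree g"
        using \<open>r < ?q\<close> assms(1) by (simp add: q divide_less_cancel)
      then show False using nz assms(1) nth_less_subdegree_zero[of i g] by (simp add: i)
    qed
  qed
qed

subsection \<open>Branches and their roots\<close>

lemma idom_prime_elem_imp_irreducible:
  fixes p :: "'a::idom"
  assumes "prime_elem p"
  shows "irreducible p"
proof (rule irreducibleI)
  show "p \<noteq> 0" "\<not> p dvd 1" using assms by (auto simp: prime_elem_def)
  have unit: "b dvd 1" if "p = a * b" "p dvd a" for a b
  proof -
    obtain c where "a = p * c" using \<open>p dvd a\<close> by (rule dvdE)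
    then have "p * (b * c) = p * 1" using that(1) by (metis mult.assoc mult.commute mult_1)
    then have "b * c = 1" using \<open>p \<noteq> 0\<close> mult_left_cancel by blast
    then show ?thesis by (metis dvd_triv_left)
  qed
  show "a dvd 1 \<or> b dvd 1" if p: "p = a * b" for a b
  proof -
    have "p dvd a * b" unfolding p[symmetric] by (rule dvd_refl)
    then have "p dvd a \<or> p dvd b" by (rule prime_elem_dvd_multD[OF assms])
    moreover have "p = b * a" by (subst mult.commute) (rule p)
    ultimately show ?thesis using unit[OF p] unit[of b a] by blast
  qed
qed

lemma prime_elem_dvd_prodD:
  fixes p :: "'a::comm_semiring_1"
  assumes "prime_elem p" "finite S" "p dvd \<Prod>S"
  shows "\<exists>a\<in>S. p dvd a"
  using assms(2,3)
proof (induction S rule: finite_induct)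
  case empty
  then show ?case using assms(1) by (simp add: prime_elem_def)
next
  case (insert a S)
  then show ?case using prime_elem_dvd_mult_iff[OF assms(1)] by auto
qed

lemma Zdiv_subset_iff: "Zdiv f \<subseteq> Zdiv g \<longleftrightarrow> g dvd f"
proof
  assume "Zdiv f \<subseteq> Zdiv g"
  moreover have "f \<in> Zdiv f" by (simp add: Zdiv_def)
  ultimately have "f \<in> Zdiv g" by (rule subsetD)
  then show "g dvd f" by (simp add: Zdiv_def)
next
  assume "g dvd f"
  then show "Zdiv f \<subseteq> Zdiv g" unfolding Zdiv_def by (intro Collect_mono impI) (rule dvd_trans)
qed

lemma Zdiv_eq_iff: "Zdiv f = Zdiv g \<longleftrightarrow> f dvd g \<and> g dvd f"
  using Zdiv_subset_iff by blast

definition parametrizes ::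
  "('r::comm_ring_1 \<Rightarrow> series2) \<Rightarrow> nat \<Rightarrow> complex fps \<Rightarrow> 'r set \<Rightarrow> bool" where
  "parametrizes \<phi> n h A \<longleftrightarrow> primitive_param n h \<and> A = Zdiv (inv \<phi> (min_poly n h))"

lemma parametrizesD:
  assumes "parametrizes \<phi> n h A"
  shows "primitive_param n h" "n > 0" "A = Zdiv (inv \<phi> (min_poly n h))"
  using assms unfolding parametrizes_def primitive_param_def by blast+

context
  fixes \<phi> :: "'r::comm_ring_1 \<Rightarrow> series2"
  assumes coordinates: "local_coordinates \<phi>"
begin

lemma coordinates_inv [simp]: "\<phi> (inv \<phi> F) = F"
  using coordinates by (simp add: local_coordinates_def bij_is_surj surj_f_inv_f)

lemma coordinates_eq_iff: "\<phi> a = \<phi> b \<longleftrightarrow> a = b"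
  using coordinates by (auto simp: local_coordinates_def bij_def inj_eq)

lemma coordinates_hom: "\<phi> (a * b) = \<phi> a * \<phi> b" "\<phi> 1 = 1" "\<phi> 0 = 0"
proof -
  show "\<phi> (a * b) = \<phi> a * \<phi> b" "\<phi> 1 = 1" using coordinates by (auto simp: local_coordinates_def)
  have "\<phi> (0 + 0) = \<phi> 0 + \<phi> 0" using coordinates unfolding local_coordinates_def by blast
  then show "\<phi> 0 = 0" by simp
qed

lemma coordinates_dvd_iff: "\<phi> a dvd \<phi> b \<longleftrightarrow> a dvd b"
proof
  assume "\<phi> a dvd \<phi> b"
  then obtain K where "\<phi> b = \<phi> a * K" by (rule dvdE)
  then have "\<phi> b = \<phi> (a * inv \<phi> K)" by (simp add: coordinates_hom)
  then show "a dvd b" by (simp add: coordinates_eq_iff)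
qed (auto simp: coordinates_hom elim!: dvdE)

lemma coordinates_is_unit_iff: "\<phi> a dvd 1 \<longleftrightarrow> a dvd 1"
  using coordinates_dvd_iff[of a 1] by (simp add: coordinates_hom)

lemma coordinates_irreducible_iff: "irreducible (\<phi> f) \<longleftrightarrow> irreducible f"
proof -
  have "(\<forall>a b. \<phi> f = a * b \<longrightarrow> a dvd 1 \<or> b dvd 1) \<longleftrightarrow> (\<forall>a b. f = a * b \<longrightarrow> a dvd 1 \<or> b dvd 1)"
  proof (intro iffI allI impI)
    fix a b assume *: "\<forall>a b. \<phi> f = a * b \<longrightarrow> a dvd 1 \<or> b dvd 1" and "f = a * b"
    then have "\<phi> f = \<phi> a * \<phi> b" by (simp add: coordinates_hom)
    then have "\<phi> a dvd 1 \<or> \<phi> b dvd 1" using * by blast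
    then show "a dvd 1 \<or> b dvd 1" by (simp add: coordinates_is_unit_iff)
  next
    fix a b assume *: "\<forall>a b. f = a * b \<longrightarrow> a dvd 1 \<or> b dvd 1" and "\<phi> f = a * b"
    then have "\<phi> f = \<phi> (inv \<phi> a * inv \<phi> b)" by (simp add: coordinates_hom)
    then have "inv \<phi> a dvd 1 \<or> inv \<phi> b dvd 1" using * coordinates_eq_iff by blast
    then show "a dvd 1 \<or> b dvd 1"
      using coordinates_is_unit_iff[of "inv \<phi> a"] coordinates_is_unit_iff[of "inv \<phi> b"] by simp
  qed
  moreover have "\<phi> f = 0 \<longleftrightarrow> f = 0" by (metis coordinates_eq_iff coordinates_hom(3))
  ultimately show ?thesis by (simp add: irreducible_def coordinates_is_unit_iff)
qed

lemma coordinates_squarefree: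
  assumes "squarefree f"
  shows "squarefree (\<phi> f)"
proof (rule squarefreeI)
  fix x assume "x\<^sup>2 dvd \<phi> f"
  moreover have "\<phi> ((inv \<phi> x)\<^sup>2) = x\<^sup>2" by (simp add: power2_eq_square coordinates_hom(1))
  ultimately have "(inv \<phi> x)\<^sup>2 dvd f" using coordinates_dvd_iff by metis
  then have "inv \<phi> x dvd 1" by (rule squarefreeD[OF assms])
  then show "x dvd 1" using coordinates_is_unit_iff[of "inv \<phi> x"] by simp
qed

text \<open>The cancellation that turns mutual divisibility into a unit factor is carried out in the
  domain \<open>series2\<close>, as the type of the local ring is only a commutative ring.\<close>

lemma defining_fn_Zdiv:
  obtains U where "U dvd 1" "\<phi> (defining_fn (Zdiv f)) = U * \<phi> f"
proof -
  define g where "g = defining_fn (Zdiv f)"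
  have "Zdiv f = Zdiv g" unfolding g_def defining_fn_def by (rule someI) (rule refl)
  then have "\<phi> g dvd \<phi> f" "\<phi> f dvd \<phi> g" by (simp_all add: Zdiv_eq_iff coordinates_dvd_iff)
  then obtain c d where cd: "\<phi> f = \<phi> g * c" "\<phi> g = \<phi> f * d" unfolding dvd_def by blast
  show thesis
  proof (cases "\<phi> f = 0")
    case True
    then have "\<phi> g = 1 * \<phi> f" using cd(2) by simp
    then show thesis using that[OF dvd_refl] unfolding g_def by blast
  next
    case False
    moreover have "\<phi> f * (d * c) = \<phi> f * 1" using cd by (simp add: mult.assoc)
    ultimately have "d * c = 1" using mult_left_cancel by blast
    then have "d dvd 1" by (metis dvd_triv_left)
    then show thesis using cd that[of d] by (simp add: g_def mult.commute)
  qed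
qed

lemma branch_parametrized:
  assumes "irreducible f" "\<not> coord_x dvd \<phi> f"
  obtains n h where "parametrizes \<phi> n h (Zdiv f)"
proof -
  obtain n h U where nh: "primitive_param n h" "U dvd 1" "\<phi> f = U * min_poly n h"
    using irreducible_min_poly[of "\<phi> f"] assms coordinates_irreducible_iff by blast
  have "\<phi> f dvd min_poly n h" "min_poly n h dvd \<phi> f"
    using nh(2,3) by (auto intro: mult_dvd_mono[of U 1 "min_poly n h" "min_poly n h", simplified])
  then have "Zdiv f = Zdiv (inv \<phi> (min_poly n h))"
    by (simp add: Zdiv_eq_iff flip: coordinates_dvd_iff)
  then show thesis using that nh(1) by (simp add: parametrizes_def)
qed

lemma defining_fn_parametrized:
  assumes "parametrizes \<phi> n h A"
  obtains U where "U dvd 1" "\<phi> (defining_fn A) = U * min_poly n h"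
proof -
  obtain U where "U dvd 1"
    "\<phi> (defining_fn (Zdiv (inv \<phi> (min_poly n h)))) = U * \<phi> (inv \<phi> (min_poly n h))"
    using defining_fn_Zdiv .
  then show thesis using that[of U] assms by (simp add: parametrizes_def)
qed

lemma roots_of_parametrized:
  assumes "parametrizes \<phi> n h A"
  shows "roots_of \<phi> A = (\<lambda>k. puiseux n (conjugate n h k)) ` {..<n}"
proof -
  obtain U where U: "U dvd 1" "\<phi> (defining_fn A) = U * min_poly n h"
    using defining_fn_parametrized[OF assms] .
  show ?thesis unfolding roots_of_def U(2) by (rule newton_puiseux_roots_min_poly[OF parametrizesD(1)[OF assms] U(1)])
qed

text \<open>Ensures that differences of roots of distinct branches are nonzero, so that
  \<open>puiseux_order\<close> is meaningful on them.\<close>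

lemma common_root_imp_eq:
  assumes A: "parametrizes \<phi> n h A" and B: "parametrizes \<phi> m g B"
    and "\<xi> \<in> roots_of \<phi> A" "\<xi> \<in> roots_of \<phi> B"
  shows "A = B"
proof -
  have *: "min_poly n h dvd min_poly m g"
    if A: "parametrizes \<phi> n h A" and B: "parametrizes \<phi> m g B"
      and \<xi>: "\<xi> \<in> roots_of \<phi> A" "\<xi> \<in> roots_of \<phi> B" for n h A m g B
  proof -
    obtain U where U: "U dvd 1" "\<phi> (defining_fn B) = U * min_poly m g"
      using defining_fn_parametrized[OF B] .
    obtain k where "\<xi> = puiseux n (conjugate n h k)"
      using \<xi>(1) roots_of_parametrized[OF A] by blast
    then have "min_poly n h dvd U * min_poly m g"
      using min_poly_dvd_if_root[OF parametrizesD(1)[OF A], of k] \<xi>(2) U by (simp add: roots_of_def)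
    moreover have "U * min_poly m g dvd 1 * min_poly m g" using U(1) by (intro mult_dvd_mono) simp_all
    ultimately have "min_poly n h dvd 1 * min_poly m g" by (rule dvd_trans)
    then show ?thesis by simp
  qed
  then have "min_poly n h dvd min_poly m g" "min_poly m g dvd min_poly n h" using assms by blast+
  then show ?thesis
    using A B by (simp add: parametrizes_def Zdiv_eq_iff flip: coordinates_dvd_iff)
qed

text \<open>Trades the maximum for the existence of a close pair of roots, a form suited to
  ultrametric arguments.\<close>

lemma coincidence_ge_iff:
  assumes A: "parametrizes \<phi> n h A" and B: "parametrizes \<phi> m g B" and "A \<noteq> B"
  shows "s \<le> ennreal_of_rat (coincidence \<phi> A B) \<longleftrightarrow>
    (\<exists>\<xi>\<in>roots_of \<phi> A. \<exists>\<xi>'\<in>roots_of \<phi> B. order_ge s (\<xi> - \<xi>'))"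
proof -
  define M where "M = {puiseux_order (\<xi> - \<xi>') | \<xi> \<xi>'. \<xi> \<in> roots_of \<phi> A \<and> \<xi>' \<in> roots_of \<phi> B}"
  note nm = parametrizesD(2)[OF A] parametrizesD(2)[OF B]
  have M: "M = (\<lambda>(\<xi>, \<xi>'). puiseux_order (\<xi> - \<xi>')) ` (roots_of \<phi> A \<times> roots_of \<phi> B)"
    by (auto simp: M_def)
  have "finite M" "M \<noteq> {}"
    unfolding M roots_of_parametrized[OF A] roots_of_parametrized[OF B] using nm by auto
  then have "Max M \<in> M" "\<And>x. x \<in> M \<Longrightarrow> x \<le> Max M" by auto
  then have "s \<le> ennreal_of_rat (Max M) \<longleftrightarrow> (\<exists>x\<in>M. s \<le> ennreal_of_rat x)"
    using ennreal_of_rat_mono order_trans by blast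
  also have "\<dots> \<longleftrightarrow> (\<exists>\<xi>\<in>roots_of \<phi> A. \<exists>\<xi>'\<in>roots_of \<phi> B. s \<le> ennreal_of_rat (puiseux_order (\<xi> - \<xi>')))"
    by (auto simp: M)
  also have "\<dots> \<longleftrightarrow> (\<exists>\<xi>\<in>roots_of \<phi> A. \<exists>\<xi>'\<in>roots_of \<phi> B. order_ge s (\<xi> - \<xi>'))"
  proof (intro bex_cong refl)
    fix \<xi> \<xi>' assume \<xi>: "\<xi> \<in> roots_of \<phi> A" "\<xi>' \<in> roots_of \<phi> B"
    then obtain k l where kl: "\<xi> = puiseux n (conjugate n h k)" "\<xi>' = puiseux m (conjugate m g l)"
      unfolding roots_of_parametrized[OF A] roots_of_parametrized[OF B] by blast
    define d where "d = (conjugate n h k oo fps_X ^ m) - (conjugate m g l oo fps_X ^ n)"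
    have d: "\<xi> - \<xi>' = puiseux (n * m) d"
      unfolding kl d_def using nm by (intro puiseux_diff_common)
    have "\<xi> \<noteq> \<xi>'" using common_root_imp_eq[OF A B] \<xi> assms(3) by blast
    then have "d \<noteq> 0"
      unfolding kl d_def using puiseux_eq_iff[OF nm(2,1), of "conjugate n h k" "conjugate m g l"] by simp
    then show "s \<le> ennreal_of_rat (puiseux_order (\<xi> - \<xi>')) \<longleftrightarrow> order_ge s (\<xi> - \<xi>')"
      unfolding d using order_ge_iff[of "n * m" d s] nm by simp
  qed
  finally show ?thesis by (simp add: coincidence_def M_def)
qed

text \<open>Conjugation multiplies coefficients by roots of unity, so all roots of a branch have the
  same support.\<close>

lemma order_ge_root_iff:
  assumes "parametrizes \<phi> n h A" "\<xi> \<in> roots_of \<phi> A"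
  shows "order_ge s \<xi> \<longleftrightarrow> order_ge s (puiseux n h)"
proof -
  obtain k where "\<xi> = puiseux n (conjugate n h k)"
    using assms roots_of_parametrized[OF assms(1)] by blast
  moreover have "puiseux n (conjugate n h k) r = 0 \<longleftrightarrow> puiseux n h r = 0" for r
    by (simp add: puiseux_def)
  ultimately show ?thesis by (simp add: order_ge_def)
qed

lemma segment_index_leaf:
  assumes A: "parametrizes \<phi> n h A"
  shows "segment_index \<phi> A \<infinity> = n"
proof -
  note prim = parametrizesD(1)[OF A] and n = parametrizesD(2)[OF A]
  define Dn where "Dn = {nat (snd (quotient_of q)) | q. q \<in> char_exponents \<phi> A \<and> ennreal_of_rat q < \<infinity>}"
  have exp: "puiseux_order (puiseux n f - puiseux n g) = of_nat (subdegree (f - g)) / of_nat n"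
    if "f \<noteq> g" for f g
    using that n by (simp add: puiseux_diff puiseux_order_eq)
  have "Lcm Dn dvd n"
  proof (rule Lcm_least)
    fix b assume "b \<in> Dn"
    then obtain q where q: "b = nat (snd (quotient_of q))" "q \<in> char_exponents \<phi> A" by (auto simp: Dn_def)
    then obtain k l where "q = puiseux_order (puiseux n (conjugate n h k) - puiseux n (conjugate n h l))"
      "puiseux n (conjugate n h k) \<noteq> puiseux n (conjugate n h l)"
      by (auto simp: char_exponents_def roots_of_parametrized[OF A])
    then obtain i where "q = of_nat i / of_nat n" using exp by metis
    then show "b dvd n" using q quotient_of_denominator(1)[OF n] by simp
  qed
  moreover have "n dvd Lcm Dn"
  proof (rule ccontr)
    assume ndvd: "\<not> n dvd Lcm Dn"
    \<comment> \<open>The conjugates 0 and k are distinct; let i/n be the order of their difference.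
      As the coefficients at i differ, n does not divide k * i, hence not Lcm Dn * i. But i/n is a
      characteristic exponent, so its denominator divides the Lcm, a contradiction.\<close>
    define k where "k = Lcm Dn mod n"
    have k: "0 < k" "k < n" using ndvd n by (auto simp: k_def mod_greater_zero_iff_not_dvd)
    define d where "d = conjugate n h 0 - conjugate n h k"
    have ne: "conjugate n h 0 \<noteq> conjugate n h k"
      using inj_on_conjugate[OF prim] k by (auto simp: inj_on_def simp del: conjugate_0)
    then have "d \<noteq> 0" by (simp add: d_def)
    let ?i = "subdegree d"
    have "d $ ?i \<noteq> 0" using \<open>d \<noteq> 0\<close> by simp
    then have "unity_root n ^ (k * ?i) \<noteq> 1" unfolding d_def by auto
    then have "\<not> n dvd k * ?i" using unity_root_power_eq_1_iff[OF n] by blast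
    then have "\<not> n dvd Lcm Dn * ?i"
      unfolding k_def by (metis dvd_eq_mod_eq_0 mod_mult_left_eq)
    moreover have "of_nat ?i / of_nat n \<in> char_exponents \<phi> A"
    proof -
      have "of_nat ?i / of_nat n = puiseux_order (puiseux n (conjugate n h 0) - puiseux n (conjugate n h k))"
        using exp[OF ne] by (simp add: d_def)
      moreover have "puiseux n (conjugate n h 0) \<noteq> puiseux n (conjugate n h k)"
        using ne puiseux_inject[OF n] by blast
      moreover have root: "puiseux n (conjugate n h l) \<in> roots_of \<phi> A" if "l < n" for l
        unfolding roots_of_parametrized[OF A] by (rule image_eqI[of _ _ l]) (use that in simp_all)
      note root[OF n] root[OF k(2)]
      ultimately show ?thesis unfolding char_exponents_def by blast
    qed
    then have "nat (snd (quotient_of (of_nat ?i / of_nat n))) \<in> Dn"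
      unfolding Dn_def by (auto simp: ennreal_of_rat_def)
    then have "nat (snd (quotient_of (of_nat ?i / of_nat n))) dvd Lcm Dn" by (rule dvd_Lcm)
    ultimately show False using quotient_of_denominator(2)[OF n] by blast
  qed
  ultimately show ?thesis by (simp add: segment_index_def Dn_def dvd_antisym)
qed

subsection \<open>The Eggers-Wall tree\<close>

text \<open>Coincidences are finite, so nothing is glued at exponent infinity; singleton leaves make
  \<open>the_elem\<close> in the index meaningful.\<close>

lemma ew_leaf_eq: "A \<in> branches D \<Longrightarrow> ew_leaf \<phi> D A = {(A, \<infinity>)}"
  by (auto simp: ew_leaf_def ew_gluing_def ennreal_of_rat_def top_unique)

lemma ew_index_leaf:
  assumes "A \<in> branches D" "parametrizes \<phi> n h A"
  shows "ew_index \<phi> (ew_leaf \<phi> D A) = n"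
  using segment_index_leaf[OF assms(2)] by (simp add: ew_index_def ew_leaf_eq[OF assms(1)])

text \<open>
  The part of the transitivity of gluing that is needed for an infimum with L'; it is the
  ultrametric inequality for differences of roots.
\<close>

lemma ew_gluing_low:
  assumes param: "\<And>B. B \<in> branches D \<Longrightarrow> \<exists>n h. parametrizes \<phi> n h B"
    and B: "B \<in> branches D" "\<exists>\<xi>\<in>roots_of \<phi> B. order_ge s \<xi>"
  shows "ew_gluing \<phi> D `` {(B, s)} = {B' \<in> branches D. \<exists>\<xi>\<in>roots_of \<phi> B'. order_ge s \<xi>} \<times> {s}"
proof -
  obtain n h where nh: "parametrizes \<phi> n h B" using param B by blast
  have all: "order_ge s \<xi>" if "\<xi> \<in> roots_of \<phi> B" for \<xi>
    using B(2) order_ge_root_iff[OF nh] that by blast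
  have "B = B' \<or> s \<le> ennreal_of_rat (coincidence \<phi> B B') \<longleftrightarrow> (\<exists>\<xi>\<in>roots_of \<phi> B'. order_ge s \<xi>)"
    if B': "B' \<in> branches D" for B'
  proof (cases "B = B'")
    case True
    then show ?thesis using B(2) by simp
  next
    case False
    obtain m g where mg: "parametrizes \<phi> m g B'" using param B' by blast
    show ?thesis
      unfolding coincidence_ge_iff[OF nh mg False] using all order_ge_diff_iff B(2) False by blast
  qed
  then show ?thesis using B(1) by (auto simp: ew_gluing_def)
qed

text \<open>The points below both leaves form a chain with one class for each exponent s up to s0,
  so their infimum is the top of this chain.\<close>

lemma ew_exponent_meet:
  assumes param: "\<And>B. B \<in> branches D \<Longrightarrow> \<exists>n h. parametrizes \<phi> n h B"
    and A: "A \<in> branches D" "parametrizes \<phi> n h A"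
    and L': "L' \<in> branches D" "roots_of \<phi> L' = {\<lambda>_. 0}"
    and s0: "\<And>s. order_ge s (puiseux n h) \<longleftrightarrow> s \<le> s0"
  shows "ew_exponent (ew_meet \<phi> D A L') = s0"
proof -
  \<comment> \<open>The branches glued to L' at exponent s: as L' has only the root 0, coincidence
    at least s with L' means having a root of order at least s.\<close>
  define W where "W = (\<lambda>s. {B \<in> branches D. \<exists>\<xi>\<in>roots_of \<phi> B. order_ge s \<xi>})"
  define below where "below = (\<lambda>P. P \<in> ew_tree \<phi> D \<and> ew_le P (ew_leaf \<phi> D A) \<and> ew_le P (ew_leaf \<phi> D L'))"
  have rootA: "(\<exists>\<xi>\<in>roots_of \<phi> A. order_ge s \<xi>) \<longleftrightarrow> s \<le> s0" for s
  proof -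
    have "n > 0" using parametrizesD(2)[OF A(2)] .
    then have "roots_of \<phi> A \<noteq> {}" unfolding roots_of_parametrized[OF A(2)] by auto
    then show ?thesis using order_ge_root_iff[OF A(2)] s0 by blast
  qed
  have WA: "A \<in> W s \<longleftrightarrow> s \<le> s0" for s using A(1) rootA by (simp add: W_def)
  have WL': "L' \<in> W s" for s using L' by (simp add: W_def)
  have glue: "ew_gluing \<phi> D `` {(B, s)} = W s \<times> {s}" if "B \<in> W s" for B s
    using ew_gluing_low[OF param] that unfolding W_def by blast
  have below1: "below (W s \<times> {s})" if "s \<le> s0" for s
  proof -
    have "W s \<times> {s} \<in> ew_tree \<phi> D"
      unfolding ew_tree_def glue[OF WL', symmetric] using L'(1) by (intro quotientI) simp
    then show ?thesis
      using WA[of s] WL'[of s] that unfolding below_def ew_leaf_eq[OF A(1)] ew_leaf_eq[OF L'(1)] ew_le_def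
      by auto
  qed
  have below2: "\<exists>s\<le>s0. P = W s \<times> {s}" if P: "below P" for P
  proof -
    obtain B s where B: "B \<in> branches D" "P = ew_gluing \<phi> D `` {(B, s)}"
      using P by (auto simp: below_def ew_tree_def elim!: quotientE)
    then have "(A, s) \<in> P" "(L', s) \<in> P"
      using P unfolding below_def ew_leaf_eq[OF A(1)] ew_leaf_eq[OF L'(1)] ew_le_def
      by (auto simp: ew_gluing_def)
    \<comment> \<open>The representative B of the class P is arbitrary; that L' lies in the same
      class gives B a root of order at least s.\<close>
    have "B \<in> W s"
    proof (cases "B = L'")
      case False
      then have le: "s \<le> ennreal_of_rat (coincidence \<phi> B L')"
        using \<open>(L', s) \<in> P\<close> B by (auto simp: ew_gluing_def)
      obtain m g k l where "parametrizes \<phi> m g B" "parametrizes \<phi> k l L'"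
        using param B(1) L'(1) by blast
      then have "\<exists>\<xi>\<in>roots_of \<phi> B. order_ge s \<xi>"
        using coincidence_ge_iff[of m g B k l L' s] le False L'(2) by simp
      then show ?thesis using B(1) by (simp add: W_def)
    qed (simp add: WL')
    then have "P = W s \<times> {s}" using B(2) glue by simp
    moreover have "s \<le> s0" using \<open>(A, s) \<in> P\<close> calculation WA by blast
    ultimately show ?thesis by blast
  qed
  have le: "ew_le (W s \<times> {s}) (W t \<times> {t}) \<longleftrightarrow> s \<le> t" if "s \<le> s0" "t \<le> s0" for s t
    using WL' by (auto simp: ew_le_def)
  have meet: "ew_meet \<phi> D A L' =
      (THE P. below P \<and> (\<forall>Q. below Q \<longrightarrow> ew_le Q P))"
    unfolding ew_meet_def below_def by (rule arg_cong[of _ _ The]) blast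
  also have "\<dots> = W s0 \<times> {s0}"
  proof (rule the_equality)
    show "below (W s0 \<times> {s0}) \<and> (\<forall>Q. below Q \<longrightarrow> ew_le Q (W s0 \<times> {s0}))"
      using below1 below2 le by blast
    fix P assume P: "below P \<and> (\<forall>Q. below Q \<longrightarrow> ew_le Q P)"
    then obtain s where s: "s \<le> s0" "P = W s \<times> {s}" using below2 by blast
    then have "s0 \<le> s" using P below1[of s0] le[of s0 s] by blast
    then show "P = W s0 \<times> {s0}" using s by simp
  qed
  moreover have "snd ` (W s0 \<times> {s0}) = {s0}" using WL'[of s0] by force
  ultimately show ?thesis by (simp add: ew_exponent_def)
qed

lemma parametrizes_coord_y: "parametrizes \<phi> 1 0 (Zdiv (inv \<phi> coord_y))"
proof -
  have "primitive_param 1 0" by (simp add: primitive_param_def)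
  then show ?thesis using min_poly_0(2)[of 1] by (simp add: parametrizes_def)
qed

lemma roots_of_coord_y: "roots_of \<phi> (Zdiv (inv \<phi> coord_y)) = {\<lambda>_. 0}"
proof -
  have "conjugate 1 0 0 = 0" "puiseux 1 0 = (\<lambda>_. 0)" by (auto simp: puiseux_def)
  then show ?thesis unfolding roots_of_parametrized[OF parametrizes_coord_y] by (simp add: lessThan_Suc)
qed

lemma elementary_polygon_summand:
  assumes param: "\<And>B. B \<in> branches D \<Longrightarrow> \<exists>n h. parametrizes \<phi> n h B"
    and A: "A \<in> branches D" "parametrizes \<phi> n h A"
    and L': "L' \<in> branches D" "L' = Zdiv (inv \<phi> coord_y)"
  shows "minkowski_multiple (ew_index \<phi> (ew_leaf \<phi> D A))
      (elementary_polygon (ew_exponent (ew_meet \<phi> D A L'))) = newton_hull (supp (min_poly n h))"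
proof -
  note prim = parametrizesD(1)[OF A(2)] and n = parametrizesD(2)[OF A(2)]
  note exponent = ew_exponent_meet[OF param A L'(1) roots_of_coord_y[folded L'(2)]]
  show ?thesis
  proof (cases "h = 0")
    case True
    \<comment> \<open>The case of the branch L' itself: the exponent is infinite, n = 1, and the
      summand is the polygon of y.\<close>
    have "puiseux n h = (\<lambda>_. 0)" by (auto simp: True puiseux_def)
    then have "ew_exponent (ew_meet \<phi> D A L') = \<infinity>" by (intro exponent) (simp only: order_ge_0, simp)
    then show ?thesis
      using min_poly_0[of n] prim True ew_index_leaf[OF A]
      by (simp add: elementary_polygon_def minkowski_multiple_def supp_coord_y)
  next
    case False
    define q :: rat where "q = of_nat (subdegree h) / of_nat n"
    have "ew_exponent (ew_meet \<phi> D A L') = ennreal_of_rat q"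
      unfolding q_def puiseux_order_eq[OF n False, symmetric]
      by (intro exponent order_ge_iff n False)
    moreover have "enn2real (ennreal_of_rat q) = real (subdegree h) / real n"
      by (simp add: ennreal_of_rat_def q_def of_rat_divide)
    moreover have "ennreal_of_rat q \<noteq> \<infinity>" by (simp add: ennreal_of_rat_def)
    ultimately show ?thesis
      using newton_hull_min_poly[OF prim False] ew_index_leaf[OF A] by (simp add: elementary_polygon_def)
  qed
qed

end

section \<open>Assembling the Minkowski sum over the branches\<close>

theorem corollary6p17:
  fixes \<phi> :: "'r::comm_ring_1 \<Rightarrow> complex fps fps" and L L' C :: "'r set"
  assumes "local_coordinates \<phi>"
    and "is_cross L L'"
    and "defines_cross \<phi> L L'"
    and "curve_singularity C"
    and "reduced_curve C"
    and "L \<notin> branches C"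
  shows "newton_polygon \<phi> C =
    (\<Sum>A\<in>branches C.
       minkowski_multiple
         (ew_index \<phi> (ew_leaf \<phi> (curve_sum C L') A))
         (elementary_polygon (ew_exponent (ew_meet \<phi> (curve_sum C L') A L'))))"
proof -
  note lc = assms(1)
  have L: "L = Zdiv (inv \<phi> coord_x)" and L': "L' = Zdiv (inv \<phi> coord_y)"
    using assms(3) by (simp_all add: defines_cross_def)
  obtain f where f: "squarefree f" "C = Zdiv f" using assms(5) by (auto simp: reduced_curve_def)
  obtain f' where f': "\<not> f' dvd 1" "C = Zdiv f'" using assms(4) by (auto simp: curve_singularity_def)
  \<comment> \<open>Units are squarefree too. That f is none comes from C being a curve singularity,
    and makes the set of prime factors nonempty below.\<close>
  have nonunit: "\<not> \<phi> f dvd 1"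
    unfolding coordinates_is_unit_iff[OF lc] using f(2) f' dvd_trans by (metis Zdiv_eq_iff)
  have irr_x: "irreducible (inv \<phi> coord_x)" and irr_y: "irreducible (inv \<phi> coord_y)"
    using prime_elem_coord_x prime_elem_min_poly[OF parametrizesD(1)[OF parametrizes_coord_y[OF lc]]]
      min_poly_0(2)[OF parametrizesD(1)[OF parametrizes_coord_y[OF lc]]]
    by (simp_all add: idom_prime_elem_imp_irreducible coordinates_inv[OF lc] flip: coordinates_irreducible_iff[OF lc])
  have branches_C: "B \<in> branches C \<longleftrightarrow> (\<exists>g. irreducible g \<and> g dvd f \<and> B = Zdiv g)" for B
    unfolding branches_def branch_def f(2) using Zdiv_subset_iff by blast
  have x_dvd: "\<not> coord_x dvd \<phi> f"
  proof
    assume "coord_x dvd \<phi> f"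
    then have "inv \<phi> coord_x dvd f"
      using coordinates_dvd_iff[OF lc, of "inv \<phi> coord_x" f] by (simp add: coordinates_inv[OF lc])
    then show False using assms(6) irr_x L branches_C by blast
  qed
  define D where "D = curve_sum C L'"
  have D: "D = Zdiv (f * inv \<phi> coord_y)"
  proof
    show "D \<subseteq> Zdiv (f * inv \<phi> coord_y)"
      by (auto simp: D_def curve_sum_def f(2) L' Zdiv_def mult_dvd_mono)
    show "Zdiv (f * inv \<phi> coord_y) \<subseteq> D"
    proof
      fix g assume "g \<in> Zdiv (f * inv \<phi> coord_y)"
      then obtain c where "g = f * inv \<phi> coord_y * c" by (auto simp: Zdiv_def elim!: dvdE)
      then have "g = (f * c) * inv \<phi> coord_y" by (simp only: mult_ac)
      moreover have "f * c \<in> C" "inv \<phi> coord_y \<in> L'" by (simp_all add: f(2) L' Zdiv_def)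
      ultimately show "g \<in> D" unfolding D_def curve_sum_def by blast
    qed
  qed
  have branches_D: "B \<in> branches D \<longleftrightarrow> (\<exists>g. irreducible g \<and> g dvd f * inv \<phi> coord_y \<and> B = Zdiv g)" for B
    unfolding branches_def branch_def D using Zdiv_subset_iff by blast
  have "D \<subseteq> C" unfolding D f(2) Zdiv_subset_iff by (rule dvd_triv_left)
  then have C_D: "branches C \<subseteq> branches D" unfolding branches_def by blast
  have L'_D: "L' \<in> branches D" 
    unfolding branches_D by (intro exI[of _ "inv \<phi> coord_y"] conjI irr_y dvd_triv_right L')
  \<comment> \<open>The prime x divides neither f nor y, hence no branch of C + L' is L and each has
    a Puiseux parametrization.\<close>
  have param: "\<exists>n h. parametrizes \<phi> n h B" if B: "B \<in> branches D" for B
  proof -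
    obtain g where g: "irreducible g" "g dvd f * inv \<phi> coord_y" "B = Zdiv g"
      using B branches_D by blast
    have "\<phi> g dvd \<phi> f * coord_y"
      using g(2) unfolding coordinates_dvd_iff[OF lc, symmetric]
      by (simp add: coordinates_hom[OF lc] coordinates_inv[OF lc])
    moreover have "at_x0 coord_y \<noteq> 0"
      by (auto simp: coord_y_def fps_eq_iff intro!: exI[of _ 1])
    ultimately have "\<not> coord_x dvd \<phi> g"
      using x_dvd prime_elem_dvd_mult_iff[OF prime_elem_coord_x] coord_x_dvd_iff dvd_trans by metis
    then show ?thesis using branch_parametrized[OF lc g(1)] g(3) by metis
  qed
  obtain S U where S: "finite S" "U dvd 1" "\<phi> f = U * \<Prod>S"
    "\<And>G. G \<in> S \<Longrightarrow> \<exists>n h. primitive_param n h \<and> G = min_poly n h"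
    using squarefree_factorization[OF coordinates_squarefree[OF lc f(1)] x_dvd] by blast
  define curve where "curve = (\<lambda>G. Zdiv (inv \<phi> G))"
  have prime: "prime_elem G" if "G \<in> S" for G using S(4)[OF that] prime_elem_min_poly by blast
  have S_dvd: "G dvd \<phi> f" if "G \<in> S" for G
    using that S(1) dvd_prodI[of S G "\<lambda>x. x"] by (simp add: S(3) dvd_mult)
  \<comment> \<open>Two factors with the same divisor are associated; if they were different
    elements of S, the square of one would divide the squarefree f.\<close>
  have "inj_on curve S"
  proof (rule inj_onI, rule ccontr)
    fix G H assume GH: "G \<in> S" "H \<in> S" "curve G = curve H" "G \<noteq> H"
    have "G dvd H"
      using GH(3) coordinates_dvd_iff[OF lc, of "inv \<phi> G" "inv \<phi> H"]
      by (simp add: curve_def Zdiv_eq_iff coordinates_inv[OF lc])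
    have "\<Prod>S = G * (H * \<Prod>(S - {G} - {H}))"
      using GH S(1) by (simp add: prod.remove[of S G] prod.remove[of "S - {G}" H])
    then have "G\<^sup>2 dvd \<phi> f"
      using \<open>G dvd H\<close> by (simp add: S(3) power2_eq_square mult_dvd_mono dvd_mult dvd_mult2)
    then show False
      using coordinates_squarefree[OF lc f(1)] prime[OF GH(1)] by (auto dest: squarefreeD simp: prime_elem_def)
  qed
  \<comment> \<open>The prime element of a branch of C divides the product, hence one factor G;
    since G is irreducible, the two are associated.\<close>
  have "branches C = curve ` S"
  proof (intro equalityI subsetI)
    fix B assume "B \<in> branches C"
    obtain n h where nh: "parametrizes \<phi> n h B" using param C_D \<open>B \<in> branches C\<close> by blast
    have "f \<in> C" by (simp add: f(2) Zdiv_def)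
    then have "f \<in> B" using \<open>B \<in> branches C\<close> by (auto simp: branches_def)
    then have "inv \<phi> (min_poly n h) dvd f" using parametrizesD(3)[OF nh] by (simp add: Zdiv_def)
    then have dvd: "min_poly n h dvd U * \<Prod>S"
      using coordinates_dvd_iff[OF lc, of "inv \<phi> (min_poly n h)" f]
      by (simp add: coordinates_inv[OF lc] S(3))
    have p: "prime_elem (min_poly n h)" using prime_elem_min_poly parametrizesD(1)[OF nh] .
    then have "\<not> min_poly n h dvd U" using S(2) dvd_trans unfolding prime_elem_def by blast
    then have "min_poly n h dvd \<Prod>S" using dvd p by (simp add: prime_elem_dvd_mult_iff)
    then obtain G where G: "G \<in> S" "min_poly n h dvd G"
      using prime_elem_dvd_prodD[OF p S(1)] by blast
    obtain c where c: "G = min_poly n h * c" using G(2) by (rule dvdE)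
    moreover have "\<not> min_poly n h dvd 1" using p by (simp add: prime_elem_def)
    ultimately have "c dvd 1"
      using irreducibleD idom_prime_elem_imp_irreducible[OF prime[OF G(1)]] by blast
    then have "min_poly n h * c dvd min_poly n h * 1" by (intro mult_dvd_mono dvd_refl)
    then have "G dvd min_poly n h" by (simp add: c)
    then have "curve G = B"
      using G(2) parametrizesD(3)[OF nh] unfolding curve_def
      by (simp add: Zdiv_eq_iff coordinates_inv[OF lc] flip: coordinates_dvd_iff[OF lc])
    then show "B \<in> curve ` S" using G(1) by blast
  next
    fix B assume "B \<in> curve ` S"
    then obtain G where G: "G \<in> S" "B = curve G" by blast
    have "irreducible (inv \<phi> G)"
      using idom_prime_elem_imp_irreducible[OF prime[OF G(1)]]
      by (simp add: coordinates_inv[OF lc] flip: coordinates_irreducible_iff[OF lc])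
    moreover have "inv \<phi> G dvd f"
      using S_dvd[OF G(1)] by (simp add: coordinates_inv[OF lc] flip: coordinates_dvd_iff[OF lc])
    ultimately show "B \<in> branches C" using branches_C G(2) unfolding curve_def by blast
  qed
  moreover have "newton_polygon \<phi> C = (\<Sum>G\<in>S. newton_hull (supp G))"
  proof -
    obtain V where V: "V dvd 1" "\<phi> (defining_fn C) = V * \<phi> f"
      using defining_fn_Zdiv[OF lc, of f] f(2) by metis
    have "S \<noteq> {}" using nonunit S(2,3) by auto
    have nz: "G \<noteq> 0" if "G \<in> S" for G using prime[OF that] by (simp add: prime_elem_def)
    then have "\<Prod>S \<noteq> 0" using S(1) by (auto simp: prod_zero_iff)
    moreover have "(V * U) dvd 1" using V(1) S(2) by (metis mult_dvd_mono mult_1)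
    ultimately have "newton_hull (supp (V * U * \<Prod>S)) = newton_hull (supp (\<Prod>S))"
      by (intro newton_hull_supp_unit_mult)
    then show ?thesis
      using newton_hull_supp_prod[OF S(1) \<open>S \<noteq> {}\<close> nz]
      by (simp add: newton_polygon_def V(2) S(3) mult.assoc)
  qed
  moreover have "minkowski_multiple (ew_index \<phi> (ew_leaf \<phi> D (curve G)))
      (elementary_polygon (ew_exponent (ew_meet \<phi> D (curve G) L'))) = newton_hull (supp G)"
    if G: "G \<in> S" for G
  proof -
    obtain n h where nh: "primitive_param n h" "G = min_poly n h" using S(4)[OF G] by blast
    then have "parametrizes \<phi> n h (curve G)" by (simp add: parametrizes_def curve_def)
    moreover have "curve G \<in> branches D"
      using C_D \<open>branches C = curve ` S\<close> G by blast
    ultimately show ?thesis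
      using elementary_polygon_summand[OF lc param _ _ L'_D L'] nh(2) by blast
  qed
  ultimately show ?thesis
    unfolding D_def[symmetric] by (simp add: sum.reindex[OF \<open>inj_on curve S\<close>] o_def)
qed

end
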